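(* Let $(\Psi^j)_{j=0}^\infty$ and $(\tilde\Psi^j)_{j=0}^\infty$ be two frame-generating sequences with $\Psi^j,\tilde\Psi^j\in\Pi_{N_j}(\mathbb{S}^{d-1})$ for each $j\in\mathbb{N}_0$. Then $\mathcal{X}[(\Psi^j)_{j=0}^\infty]$ and $\mathcal{X}[(\tilde\Psi^j)_{j=0}^\infty]$ are dual frames, i.e. $$f=\sum_{j=0}^\infty\sum_{r=1}^{r_j}\mu_{j,r}\,\langle f,T^d(g_{j,r})\Psi^j\rangle_{\mathbb{S}^{d-1}}\,T^d(g_{j,r})\tilde\Psi^j\qquad\text{for each } f\in L^2(\mathbb{S}^{d-1}),$$ if and only if $$(\dim\mathcal{H}_n^d)^{-1}\sum_{j=0}^\infty\sum_{k\in\mathcal{I}_n^d}\overline{\Psi^j(n,k)}\,\tilde\Psi^j(n,k)=1\qquad\text{for all } n\in\mathbb{N}_0.$$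
   Context: Fix $d\ge3$. $\mathbb{S}^{d-1}$ is the unit sphere in $\mathbb{R}^d$ and $\omega_{d-1}$ is the rotation-invariant measure on it normalized by $\omega_{d-1}(\mathbb{S}^{d-1})=1$; $L^2(\mathbb{S}^{d-1})$ (complex-valued functions) has inner product $\langle f_1,f_2\rangle_{\mathbb{S}^{d-1}}=\int f_1\overline{f_2}\,\mathrm{d}\omega_{d-1}$. $\mathcal{H}_n^d$ is the space of spherical harmonics of degree $n$ (restrictions to $\mathbb{S}^{d-1}$ of complex harmonic homogeneous polynomials of degree $n$ on $\mathbb{R}^d$), and $\Pi_N(\mathbb{S}^{d-1})=\bigoplus_{n=0}^N\mathcal{H}_n^d$ is the space of restrictions to the sphere of polynomials of degree at most $N$. For each $n\in\mathbb{N}_0$, $\mathcal{I}_n^d$ is an index set of cardinality $\dim\mathcal{H}_n^d$ and $\{Y_k^{d,n}: k\in\mathcal{I}_n^d\}$ is a fixed orthonormal basis of $\mathcal{H}_n^d$. Fourier coefficients are written $f(n,k)=\langle f,Y_k^{d,n}\rangle_{\mathbb{S}^{d-1}}$. $\mu_d$ is the normalized Haar measure on $SO(d)$, and $(T^d(g)f)(x)=f(g^{-1}x)$ for $g\in SO(d)$. Let $t_{k,m}^{d,n}(g)=\langle T^d(g)Y_m^{d,n},Y_k^{d,n}\rangle_{\mathbb{S}^{d-1}}$ and $\mathcal{M}_N^1(SO(d))=\mathrm{span}\{t_{k,m}^{d,n}: k,m\in\mathcal{I}_n^d,\ 0\le n\le N\}$. Fix an increasing sequence $(N_j)_{j=0}^\infty\subset\mathbb{N}_0$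 and, for every $j\in\mathbb{N}_0$, points $g_{j,r}\in SO(d)$ and weights $\mu_{j,r}>0$, $r=1,\dots,r_j$, such that $$\int_{SO(d)}f_1f_2\,\mathrm{d}\mu_d=\sum_{r=1}^{r_j}\mu_{j,r}f_1(g_{j,r})f_2(g_{j,r})\quad\text{for all } f_1,f_2\in\mathcal{M}_{N_j}^1(SO(d)).$$ For a sequence $(\Psi^j)_{j=0}^\infty$ with $\Psi^j\in\Pi_{N_j}(\mathbb{S}^{d-1})$ put $$\mathcal{X}[(\Psi^j)_{j=0}^\infty]=\{\sqrt{\mu_{j,r}}\,T^d(g_{j,r})\Psi^j:\ r=1,\dots,r_j,\ j\in\mathbb{N}_0\},$$ regarded as a (canonically ordered) sequence of elements of $L^2(\mathbb{S}^{d-1})$. The sequence $(\Psi^j)_{j=0}^\infty$ is called frame-generating if $\mathcal{X}[(\Psi^j)_{j=0}^\infty]$ is a frame for $L^2(\mathbb{S}^{d-1})$. *)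

theory Defs
  imports "HOL-Analysis.Analysis" "HOL-Library.Function_Algebras"
begin

section \<open>Complex-valued functions as a complex vector space\<close>

definition cfun_scale :: "complex \<Rightarrow> ('a \<Rightarrow> complex) \<Rightarrow> 'a \<Rightarrow> complex" where
  "cfun_scale c f = (\<lambda>x. c * f x)"

global_interpretation cfun: vector_space cfun_scale
  by unfold_locales (auto simp: cfun_scale_def fun_eq_iff algebra_simps)

section \<open>The rotation group, the sphere and their invariant measures\<close>

definition SO :: "(real ^ 'n ^ 'n) set" where
  "SO = {g. rotation_matrix g}"

definition invariant_sphere_measure :: "(real ^ 'n) measure \<Rightarrow> bool" where
  "invariant_sphere_measure \<omega> \<longleftrightarrow>
     sets \<omega> = sets (restrict_space borel (sphere 0 1)) \<and>
     emeasure \<omega> (sphere 0 1) = 1 \<and>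
     (\<forall>g\<in>SO. distr \<omega> \<omega> (\<lambda>x. g *v x) = \<omega>)"

text \<open>Left invariance suffices: \<open>SO\<close> is a compact metric group, so a left-invariant Borel
  probability measure on it is Radon and also right-invariant.\<close>

definition normalized_haar_SO :: "(real ^ 'n ^ 'n) measure \<Rightarrow> bool" where
  "normalized_haar_SO \<mu> \<longleftrightarrow>
     sets \<mu> = sets (restrict_space borel SO) \<and>
     emeasure \<mu> SO = 1 \<and>
     (\<forall>h\<in>SO. distr \<mu> \<mu> (\<lambda>g. h ** g) = \<mu>)"

definition rot :: "real ^ 'n ^ 'n \<Rightarrow> (real ^ 'n \<Rightarrow> complex) \<Rightarrow> real ^ 'n \<Rightarrow> complex" where
  "rot g f = (\<lambda>x. f (matrix_inv g *v x))"

section \<open>Square-integrable functions\<close>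

text \<open>Elements of \<open>L\<^sup>2\<close> are represented by functions; equality in \<open>L\<^sup>2\<close> is distance \<open>0\<close> in
  \<open>L2_norm\<close>. For a measure on the sphere, values off the sphere are irrelevant.\<close>

definition L2 :: "'a measure \<Rightarrow> ('a \<Rightarrow> complex) set" where
  "L2 M = {f. f \<in> borel_measurable M \<and> integrable M (\<lambda>x. (cmod (f x))\<^sup>2)}"

definition L2_inner :: "'a measure \<Rightarrow> ('a \<Rightarrow> complex) \<Rightarrow> ('a \<Rightarrow> complex) \<Rightarrow> complex" where
  "L2_inner M f h = (LINT x|M. f x * cnj (h x))"

definition L2_norm :: "'a measure \<Rightarrow> ('a \<Rightarrow> complex) \<Rightarrow> real" where
  "L2_norm M f = sqrt (LINT x|M. (cmod (f x))\<^sup>2)"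

definition L2_sums :: "'a measure \<Rightarrow> (nat \<Rightarrow> 'a \<Rightarrow> complex) \<Rightarrow> ('a \<Rightarrow> complex) \<Rightarrow> bool" where
  "L2_sums M u f \<longleftrightarrow> (\<lambda>J. L2_norm M (\<lambda>x. f x - (\<Sum>j<J. u j x))) \<longlonglongrightarrow> 0"

definition L2_frame :: "'a measure \<Rightarrow> 'i set \<Rightarrow> ('i \<Rightarrow> 'a \<Rightarrow> complex) \<Rightarrow> bool" where
  "L2_frame M S F \<longleftrightarrow>
     (\<forall>i\<in>S. F i \<in> L2 M) \<and>
     (\<exists>A B. 0 < A \<and> A \<le> B \<and>
        (\<forall>f\<in>L2 M.
           (\<lambda>i. (cmod (L2_inner M f (F i)))\<^sup>2) summable_on S \<and>
           A * (L2_norm M f)\<^sup>2 \<le> (\<Sum>\<^sub>\<infinity>i\<in>S. (cmod (L2_inner M f (F i)))\<^sup>2) \<and>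
           (\<Sum>\<^sub>\<infinity>i\<in>S. (cmod (L2_inner M f (F i)))\<^sup>2) \<le> B * (L2_norm M f)\<^sup>2))"

section \<open>Spherical harmonics\<close>

definition partial_derivative :: "'n \<Rightarrow> (real ^ 'n \<Rightarrow> complex) \<Rightarrow> real ^ 'n \<Rightarrow> complex" where
  "partial_derivative i p x = frechet_derivative p (at x) (axis i 1)"

definition laplacian :: "(real ^ 'n \<Rightarrow> complex) \<Rightarrow> real ^ 'n \<Rightarrow> complex" where
  "laplacian p x = (\<Sum>i\<in>UNIV. partial_derivative i (partial_derivative i p) x)"

text \<open>For a complex-valued function, \<^const>\<open>polynomial_function\<close> says that its real and
  imaginary parts are real polynomials in the coordinates, i.e. it is a polynomial with complex
  coefficients.\<close>

definition harmonic_homogeneous_poly :: "nat \<Rightarrow> (real ^ 'n \<Rightarrow> complex) \<Rightarrow> bool" where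
  "harmonic_homogeneous_poly n p \<longleftrightarrow>
     polynomial_function p \<and>
     (\<forall>t x. p (t *\<^sub>R x) = of_real (t ^ n) * p x) \<and>
     (\<forall>x. laplacian p x = 0)"

text \<open>Functions on the sphere are extended by \<open>0\<close>, so that equality of functions is equality on
  the sphere, and the linear span and dimension are those of functions on the sphere.\<close>

definition sphere_restrict :: "(real ^ 'n \<Rightarrow> complex) \<Rightarrow> real ^ 'n \<Rightarrow> complex" where
  "sphere_restrict p = (\<lambda>x. if x \<in> sphere 0 1 then p x else 0)"

definition spherical_harmonics :: "nat \<Rightarrow> (real ^ 'n \<Rightarrow> complex) set" where
  "spherical_harmonics n = sphere_restrict ` {p. harmonic_homogeneous_poly n p}"

definition sphere_polys :: "nat \<Rightarrow> (real ^ 'n \<Rightarrow> complex) set" where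
  "sphere_polys N = {\<Sum>n\<le>N. h n | h. \<forall>n\<le>N. h n \<in> spherical_harmonics n}"

definition orthonormal_basis_of ::
    "'a measure \<Rightarrow> ('a \<Rightarrow> complex) set \<Rightarrow> 'k set \<Rightarrow> ('k \<Rightarrow> 'a \<Rightarrow> complex) \<Rightarrow> bool" where
  "orthonormal_basis_of M V K Y \<longleftrightarrow>
     (\<forall>k\<in>K. Y k \<in> V) \<and>
     (\<forall>k\<in>K. \<forall>m\<in>K. L2_inner M (Y k) (Y m) = (if k = m then 1 else 0)) \<and>
     cfun.span (Y ` K) = V"

section \<open>Matrix coefficients, quadrature and the systems generated by rotations\<close>

definition matrix_coeff ::
    "(real ^ 'n) measure \<Rightarrow> (nat \<Rightarrow> 'k \<Rightarrow> real ^ 'n \<Rightarrow> complex) \<Rightarrow>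
     nat \<Rightarrow> 'k \<Rightarrow> 'k \<Rightarrow> real ^ 'n ^ 'n \<Rightarrow> complex" where
  "matrix_coeff \<omega> Y n k m = (\<lambda>g. L2_inner \<omega> (rot g (Y n m)) (Y n k))"

text \<open>The functions below are total on matrices; only their values on \<open>SO\<close> are ever used.\<close>

definition matrix_coeff_span ::
    "(real ^ 'n) measure \<Rightarrow> (nat \<Rightarrow> 'k set) \<Rightarrow> (nat \<Rightarrow> 'k \<Rightarrow> real ^ 'n \<Rightarrow> complex) \<Rightarrow>
     nat \<Rightarrow> (real ^ 'n ^ 'n \<Rightarrow> complex) set" where
  "matrix_coeff_span \<omega> \<I> Y N =
     cfun.span {matrix_coeff \<omega> Y n k m | n k m. n \<le> N \<and> k \<in> \<I> n \<and> m \<in> \<I> n}"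

definition quadrature_on ::
    "(real ^ 'n ^ 'n) measure \<Rightarrow> (real ^ 'n ^ 'n \<Rightarrow> complex) set \<Rightarrow>
     nat \<Rightarrow> (nat \<Rightarrow> real ^ 'n ^ 'n) \<Rightarrow> (nat \<Rightarrow> real) \<Rightarrow> bool" where
  "quadrature_on \<mu> V R g w \<longleftrightarrow>
     (\<forall>f\<^sub>1\<in>V. \<forall>f\<^sub>2\<in>V.
        (LINT h|\<mu>. f\<^sub>1 h * f\<^sub>2 h) = (\<Sum>r=1..R. of_real (w r) * f\<^sub>1 (g r) * f\<^sub>2 (g r)))"

text \<open>The system generated by \<open>\<Psi>\<close> is a family indexed by the pairs \<open>(j, r)\<close> with
  \<open>1 \<le> r \<le> R j\<close> (so repeated elements count with multiplicity); the frame property does not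
  depend on the order of the index set.\<close>

definition system_index :: "(nat \<Rightarrow> nat) \<Rightarrow> (nat \<times> nat) set" where
  "system_index R = (SIGMA j:UNIV. {1..R j})"

definition rotated_system ::
    "(nat \<Rightarrow> nat \<Rightarrow> real ^ 'n ^ 'n) \<Rightarrow> (nat \<Rightarrow> nat \<Rightarrow> real) \<Rightarrow>
     (nat \<Rightarrow> real ^ 'n \<Rightarrow> complex) \<Rightarrow> nat \<times> nat \<Rightarrow> real ^ 'n \<Rightarrow> complex" where
  "rotated_system g w \<Psi> = (\<lambda>(j, r) x. of_real (sqrt (w j r)) * rot (g j r) (\<Psi> j) x)"

definition frame_generating ::
    "(real ^ 'n) measure \<Rightarrow> (nat \<Rightarrow> nat) \<Rightarrow> (nat \<Rightarrow> nat \<Rightarrow> real ^ 'n ^ 'n) \<Rightarrow>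
     (nat \<Rightarrow> nat \<Rightarrow> real) \<Rightarrow> (nat \<Rightarrow> real ^ 'n \<Rightarrow> complex) \<Rightarrow> bool" where
  "frame_generating \<omega> R g w \<Psi> \<longleftrightarrow> L2_frame \<omega> (system_index R) (rotated_system g w \<Psi>)"

end

theory Submission
  imports Defs
begin

text \<open>
  By the quadrature formula, the kernel
  \<open>K(x, y) = \<Sum>r. w r * (T(g r) \<Psi>')(x) * cnj ((T(g r) \<Psi>)(y))\<close> of the \<open>j\<close>-th partial operator is an
  integral over the rotation group, hence rotation invariant, and so are its components of degree
  \<open>n\<close> in \<open>x\<close> and \<open>m\<close> in \<open>y\<close>. For \<open>n \<noteq> m\<close> such a component vanishes, because rotations can swap two
  points and harmonics of different degree are orthogonal; for \<open>n = m\<close> it is a multiple of the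
  reproducing kernel, because a zonal harmonic is determined by its value at the pole. Comparing
  traces, the \<open>j\<close>-th operator multiplies the degree-\<open>n\<close> part of \<open>f\<close> by
  \<open>c j n = (\<Sum>k. cnj (\<Psi>(n,k)) * \<Psi>'(n,k)) / dim H_n\<close>. Consequently the squared norm of \<open>f\<close> minus
  the \<open>J\<close>-th partial sum is the sum over \<open>n\<close> of \<open>|1 - (\<Sum>j<J. c j n)|^2\<close> times the energy of \<open>f\<close> in
  degree \<open>n\<close>. The upper frame bounds bound the coefficients \<open>\<Sum>j<J. c j n\<close> uniformly, so this tends to
  \<open>0\<close> for all \<open>f\<close> iff these coefficients tend to \<open>1\<close> for each \<open>n\<close>.
\<close>

section \<open>Polynomials on Euclidean space and their derivatives\<close>

text \<open>The measure on the sphere is known only through its invariance, so surface integrals and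
  Green's formula are not at hand. The generators of plane rotations take their place: such a
  derivative has mean 0, and the sum of their squares over ordered pairs acts on harmonics of degree
  \<open>n\<close> as the scalar \<open>- 2 * n * (n + d - 2)\<close> with
  \<open>d = CARD('n)\<close>. These scalars differ for different degrees, which gives
  orthogonality. The bound \<open>d >= 3\<close> provides a reflection that fixes two given points.
  It repairs the determinant of an isometry that carries one pair of points to another, and this is
  why a rotation, not only a reflection, can swap two points. The factor \<open>1 / dim H_n\<close>
  is a ratio of two traces. Each rotated copy contributes the same inner product to the trace of the
  degree-\<open>n\<close> kernel and the weights sum to 1, whereas the trace of the reproducing
  kernel is the number of basis functions.\<close>

inductive cpoly :: "(real ^ 'n \<Rightarrow> complex) \<Rightarrow> bool" where
  cpoly_const: "cpoly (\<lambda>x. c)"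
| cpoly_coord: "cpoly (\<lambda>x. complex_of_real (x $ i))"
| cpoly_add: "cpoly p \<Longrightarrow> cpoly q \<Longrightarrow> cpoly (\<lambda>x. p x + q x)"
| cpoly_mult: "cpoly p \<Longrightarrow> cpoly q \<Longrightarrow> cpoly (\<lambda>x. p x * q x)"

lemma cpoly_diff: "cpoly p \<Longrightarrow> cpoly q \<Longrightarrow> cpoly (\<lambda>x. p x - q x)"
  using cpoly_add[OF _ cpoly_mult[OF cpoly_const[of "-1"]], of p q] by simp

lemma cpoly_sum: "(\<And>i. i \<in> S \<Longrightarrow> cpoly (p i)) \<Longrightarrow> cpoly (\<lambda>x. \<Sum>i\<in>S. p i x)"
  by (induction S rule: infinite_finite_induct) (simp_all add: cpoly_const cpoly_add)

lemma cpoly_power: "cpoly p \<Longrightarrow> cpoly (\<lambda>x. p x ^ n)"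
  by (induction n) (simp_all add: cpoly_const cpoly_mult)

lemma cpoly_cnj: "cpoly p \<Longrightarrow> cpoly (\<lambda>x. cnj (p x))"
  by (induction rule: cpoly.induct) (simp_all add: cpoly.intros)

lemma cpoly_matrix_vector_mult:
  fixes A :: "real ^ 'n ^ 'm"
  assumes "cpoly p" shows "cpoly (\<lambda>x. p (A *v x))"
  using assms
proof (induction rule: cpoly.induct)
  case (cpoly_coord i)
  have "cpoly (\<lambda>x. \<Sum>j\<in>UNIV. complex_of_real (A $ i $ j) * complex_of_real (x $ j))"
    by (intro cpoly_sum cpoly.cpoly_mult cpoly.cpoly_coord cpoly_const)
  then show ?case by (simp add: matrix_vector_mult_def)
qed (simp_all add: cpoly.intros)

lemma cpoly_of_real:
  assumes "real_polynomial_function p" shows "cpoly (\<lambda>x. complex_of_real (p x))"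
  using assms
proof (induction rule: real_polynomial_function.induct)
  case (linear f)
  have *: "f x = (\<Sum>i\<in>UNIV. x $ i * f (axis i 1))" for x
  proof -
    interpret f: bounded_linear f by fact
    have "f x = f (\<Sum>i\<in>UNIV. (x $ i) *\<^sub>R axis i 1)"
      by (simp only: scalar_mult_eq_scaleR[symmetric] basis_expansion)
    then show ?thesis by (simp add: f.sum f.scaleR)
  qed
  have "(\<lambda>x. complex_of_real (f x))
      = (\<lambda>x. \<Sum>i\<in>UNIV. complex_of_real (x $ i) * complex_of_real (f (axis i 1)))"
    by (rule ext, subst *) simp
  then show ?case
    by (simp only:) (intro cpoly_sum cpoly_mult cpoly_coord cpoly_const)
qed (simp_all add: cpoly.intros)

text \<open>Trades a notion that speaks of real and imaginary parts for an inductive class of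
  complex functions, so that closure under partial derivatives and conjugation can be proved by
  induction.\<close>

lemma polynomial_function_iff_cpoly:
  fixes p :: "real ^ 'n \<Rightarrow> complex"
  shows "polynomial_function p \<longleftrightarrow> cpoly p"
proof
  assume "polynomial_function p"
  then have "real_polynomial_function (\<lambda>x. Re (p x))" "real_polynomial_function (\<lambda>x. Im (p x))"
    by (auto simp: polynomial_function_iff_Basis_inner[where 'b=complex] Basis_complex_def)
  then have "cpoly (\<lambda>x. complex_of_real (Re (p x)) + \<i> * complex_of_real (Im (p x)))"
    by (intro cpoly_add cpoly_mult cpoly_const cpoly_of_real)
  then show "cpoly p" by (simp only: complex_eq[symmetric])
next
  assume "cpoly p"
  then have "polynomial_function (\<lambda>x. Re (p x)) \<and> polynomial_function (\<lambda>x. Im (p x))"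
  proof (induction rule: cpoly.induct)
    case (cpoly_coord i)
    have "polynomial_function (\<lambda>x::real^'n. x $ i)"
      by (intro polynomial_function_bounded_linear bounded_linear_vec_nth)
    then show ?case by (simp add: polynomial_function_const)
  next
    case (cpoly_mult p q)
    then show ?case
      by (simp add: polynomial_function_diff polynomial_function_add
          polynomial_function_mult[where 'b=real, unfolded real_scaleR_def])
  qed (simp_all add: polynomial_function_add polynomial_function_const)
  then show "polynomial_function p"
    by (subst polynomial_function_iff_Basis_inner)
      (simp add: Basis_complex_def real_polynomial_function_eq)
qed

lemma cpoly_differentiable: "cpoly p \<Longrightarrow> p differentiable at x"
  by (simp add: differentiable_at_polynomial_function polynomial_function_iff_cpoly)

lemma cpoly_has_derivative:
  assumes "cpoly p"
  shows "(p has_derivative (\<lambda>v. \<Sum>i\<in>UNIV. complex_of_real (v $ i) * partial_derivative i p x)) (at x)"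
proof -
  have *: "(p has_derivative frechet_derivative p (at x)) (at x)"
    using cpoly_differentiable[OF assms] by (simp add: frechet_derivative_works)
  then interpret D: bounded_linear "frechet_derivative p (at x)" by (rule has_derivative_bounded_linear)
  have "frechet_derivative p (at x) v
      = (\<Sum>i\<in>UNIV. complex_of_real (v $ i) * partial_derivative i p x)" for v
  proof -
    have "frechet_derivative p (at x) v = frechet_derivative p (at x) (\<Sum>i\<in>UNIV. (v $ i) *\<^sub>R axis i 1)"
      by (simp only: scalar_mult_eq_scaleR[symmetric] basis_expansion)
    also have "\<dots> = (\<Sum>i\<in>UNIV. complex_of_real (v $ i) * partial_derivative i p x)"
      by (simp only: D.sum D.scaleR partial_derivative_def
          scaleR_conv_of_real[where 'a=complex])
    finally show ?thesis .
  qed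
  then have "frechet_derivative p (at x) = (\<lambda>v. \<Sum>i\<in>UNIV. complex_of_real (v $ i) * partial_derivative i p x)"
    by (rule ext)
  then show ?thesis using * by simp
qed

lemma partial_derivative_eqI:
  "(p has_derivative D) (at x) \<Longrightarrow> partial_derivative i p x = D (axis i 1)"
  unfolding partial_derivative_def by (simp add: frechet_derivative_at[symmetric])

lemma partial_derivative_const [simp]: "partial_derivative i (\<lambda>x. c) = (\<lambda>x. 0)"
  by (rule ext) (auto intro!: partial_derivative_eqI[THEN trans] derivative_eq_intros)

lemma partial_derivative_coord [simp]:
  fixes i j :: "'n::finite"
  shows "partial_derivative i (\<lambda>x. complex_of_real (x $ j)) = (\<lambda>x. if i = j then 1 else 0)"
proof
  fix x :: "real ^ 'n"
  have "((\<lambda>x. complex_of_real (x $ j)) has_derivative (\<lambda>v. complex_of_real (v $ j))) (at x)"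
    by (intro has_derivative_of_real bounded_linear_imp_has_derivative bounded_linear_vec_nth)
  from partial_derivative_eqI[OF this, of i]
  show "partial_derivative i (\<lambda>x. complex_of_real (x $ j)) x = (if i = j then 1 else 0)"
    by (simp add: axis_def)
qed

lemma partial_derivative_add:
  assumes "cpoly p" "cpoly q"
  shows "partial_derivative i (\<lambda>x. p x + q x) = (\<lambda>x. partial_derivative i p x + partial_derivative i q x)"
  using partial_derivative_eqI[OF has_derivative_add[OF cpoly_has_derivative[OF assms(1)] cpoly_has_derivative[OF assms(2)]]]
  by (auto simp: axis_def if_distrib if_distribR sum.delta cong: if_cong)

lemma partial_derivative_mult:
  assumes "cpoly p" "cpoly q"
  shows "partial_derivative i (\<lambda>x. p x * q x)
    = (\<lambda>x. p x * partial_derivative i q x + partial_derivative i p x * q x)"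
  using partial_derivative_eqI[OF has_derivative_mult[OF cpoly_has_derivative[OF assms(1)] cpoly_has_derivative[OF assms(2)]]]
  by (auto simp: axis_def if_distrib if_distribR sum.delta cong: if_cong)

lemma partial_derivative_cmult:
  "cpoly p \<Longrightarrow> partial_derivative i (\<lambda>x. c * p x) = (\<lambda>x. c * partial_derivative i p x)"
  by (simp add: partial_derivative_mult cpoly_const)

lemma partial_derivative_diff:
  assumes "cpoly p" "cpoly q"
  shows "partial_derivative i (\<lambda>x. p x - q x) = (\<lambda>x. partial_derivative i p x - partial_derivative i q x)"
  using partial_derivative_eqI[OF has_derivative_diff[OF cpoly_has_derivative[OF assms(1)] cpoly_has_derivative[OF assms(2)]]]
  by (auto simp: axis_def if_distrib if_distribR sum.delta cong: if_cong)

lemma partial_derivative_sum: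
  assumes "\<And>k. k \<in> S \<Longrightarrow> cpoly (p k)"
  shows "partial_derivative i (\<lambda>x. \<Sum>k\<in>S. p k x) = (\<lambda>x. \<Sum>k\<in>S. partial_derivative i (p k) x)"
  using assms
  by (induction S rule: infinite_finite_induct) (auto simp: partial_derivative_add cpoly_sum)

lemma cpoly_partial_derivative: "cpoly p \<Longrightarrow> cpoly (partial_derivative i p)"
  by (induction rule: cpoly.induct)
    (simp_all add: partial_derivative_add partial_derivative_mult cpoly.intros)

text \<open>For polynomials the symmetry of second derivatives follows by induction from the sum and
  product rules, since it is trivial for constants and coordinates.\<close>

lemma partial_derivative_commute:
  "cpoly p \<Longrightarrow> partial_derivative i (partial_derivative j p) = partial_derivative j (partial_derivative i p)"
proof (induction rule: cpoly.induct)
  case (cpoly_coord k)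
  show ?case by simp
qed (auto simp: partial_derivative_add partial_derivative_mult cpoly_partial_derivative cpoly.intros algebra_simps)

lemma laplacian_partial_derivative:
  assumes "cpoly p"
  shows "laplacian (partial_derivative i p) = partial_derivative i (laplacian p)"
  unfolding laplacian_def
  by (simp add: partial_derivative_sum cpoly_partial_derivative assms
      partial_derivative_commute[of p] partial_derivative_commute[of "partial_derivative _ p" i] )

lemma partial_derivative_cnj:
  assumes "cpoly p"
  shows "partial_derivative i (\<lambda>x. cnj (p x)) = (\<lambda>x. cnj (partial_derivative i p x))"
  using partial_derivative_eqI[OF has_derivative_cnj[OF cpoly_has_derivative[OF assms]]]
  by (auto simp: axis_def if_distrib if_distribR sum.delta cong: if_cong)

lemma partial_derivative_linear_image:
  fixes A :: "real ^ 'n ^ 'm"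
  assumes "cpoly p"
  shows "partial_derivative i (\<lambda>x. p (A *v x))
    = (\<lambda>x. \<Sum>k\<in>UNIV. complex_of_real (A $ k $ i) * partial_derivative k p (A *v x))"
proof
  fix x
  have "((*v) A has_derivative (*v) A) (at x)"
    by (intro bounded_linear_imp_has_derivative) (simp add: linear_linear)
  from partial_derivative_eqI[OF has_derivative_compose[OF this cpoly_has_derivative[OF assms]], of i]
  show "partial_derivative i (\<lambda>x. p (A *v x)) x
    = (\<Sum>k\<in>UNIV. complex_of_real (A $ k $ i) * partial_derivative k p (A *v x))"
    by (simp add: matrix_vector_mul_component inner_axis)
qed

lemma partial_derivative_scaleR:
  fixes p :: "real ^ 'n \<Rightarrow> complex"
  assumes "cpoly p"
  shows "partial_derivative i (\<lambda>x. p (t *\<^sub>R x)) = (\<lambda>x. t * partial_derivative i p (t *\<^sub>R x))"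
proof
  fix x :: "real^'n"
  have "((*\<^sub>R) t has_derivative (*\<^sub>R) t) (at x)"
    by (intro bounded_linear_imp_has_derivative bounded_linear_scaleR_right)
  from partial_derivative_eqI[OF has_derivative_compose[OF this cpoly_has_derivative[OF assms]], of i]
  show "partial_derivative i (\<lambda>x. p (t *\<^sub>R x)) x = t * partial_derivative i p (t *\<^sub>R x)"
    by (simp add: axis_def if_distrib if_distribR sum.delta cong: if_cong)
qed

lemma cpoly_continuous_on: "cpoly p \<Longrightarrow> continuous_on S p"
  by (simp add: continuous_on_polymonial_function polynomial_function_iff_cpoly)

text \<open>The chain rule, used twice, produces the entries of \<open>A ** transpose A\<close>,
  which is the identity matrix.\<close>

lemma laplacian_orthogonal:
  assumes "cpoly p" "orthogonal_matrix A"
  shows "laplacian (\<lambda>x. p (A *v x)) = (\<lambda>x. laplacian p (A *v x))"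
proof
  fix x
  have A: "(\<Sum>i\<in>UNIV. A $ k $ i * A $ l $ i) = (if k = l then 1 else 0)" for k l
  proof -
    have "(A ** transpose A) $ k $ l = mat 1 $ k $ l"
      using assms(2) by (simp add: orthogonal_matrix_def)
    then show ?thesis by (simp add: matrix_matrix_mult_def transpose_def mat_def)
  qed
  have "laplacian (\<lambda>x. p (A *v x)) x = (\<Sum>i\<in>UNIV. \<Sum>k\<in>UNIV. \<Sum>l\<in>UNIV.
     complex_of_real (A $ k $ i * A $ l $ i) * partial_derivative l (partial_derivative k p) (A *v x))"
    unfolding laplacian_def
    by (simp add: partial_derivative_linear_image assms(1) partial_derivative_sum partial_derivative_cmult
        cpoly_mult cpoly_const cpoly_matrix_vector_mult cpoly_partial_derivative sum_distrib_left mult.assoc)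
  also have "\<dots> = (\<Sum>k\<in>UNIV. \<Sum>l\<in>UNIV. complex_of_real (\<Sum>i\<in>UNIV. A $ k $ i * A $ l $ i)
       * partial_derivative l (partial_derivative k p) (A *v x))"
    by (subst sum.swap, rule sum.cong[OF refl], subst sum.swap) (simp add: sum_distrib_right)
  also have "\<dots> = laplacian p (A *v x)"
    by (simp add: A laplacian_def if_distrib if_distribR sum.delta cong: if_cong)
  finally show "laplacian (\<lambda>x. p (A *v x)) x = laplacian p (A *v x)" .
qed

section \<open>Rotations and angular derivatives\<close>

lemma exists_distinct_index:
  fixes k :: "'n::finite"
  assumes "CARD('n) \<ge> 2"
  obtains j where "j \<noteq> k"
  using assms by (metis UNIV_eq_I card.empty card.insert empty_iff finite.emptyI not_less_eq_eq
      numeral_2_eq_2 le0 singleton_iff)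

lemma SO_orthogonal: "g \<in> SO \<Longrightarrow> orthogonal_matrix g"
  by (simp add: SO_def rotation_matrix_def)

lemma SO_orthogonal_transformation: "g \<in> SO \<Longrightarrow> orthogonal_transformation ((*v) g)"
  by (simp add: SO_orthogonal orthogonal_transformation_matrix)

lemma SO_norm [simp]: "g \<in> SO \<Longrightarrow> norm (g *v x) = norm x"
  by (metis SO_orthogonal_transformation orthogonal_transformation_norm)

lemma SO_inner: "g \<in> SO \<Longrightarrow> (g *v x) \<bullet> (g *v y) = x \<bullet> y"
  by (metis SO_orthogonal_transformation orthogonal_transformation_def)

lemma SO_transpose: "g \<in> SO \<Longrightarrow> transpose g \<in> SO"
  by (simp add: SO_def rotation_matrix_def orthogonal_matrix_transpose det_transpose)

lemma SO_mult: "g \<in> SO \<Longrightarrow> h \<in> SO \<Longrightarrow> g ** h \<in> SO"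
  by (simp add: SO_def rotation_matrix_def orthogonal_matrix_mul det_mul)

text \<open>\<open>matrix_inv\<close> is given by a choice, but inverses are unique. The transpose
  is again in \<open>SO\<close> and depends continuously on \<open>g\<close>, which
  \<open>rot\<close> needs later.\<close>

lemma SO_matrix_inv:
  assumes "g \<in> SO" shows "matrix_inv g = transpose g"
proof -
  have *: "g ** transpose g = mat 1" "transpose g ** g = mat 1"
    using SO_orthogonal[OF assms] by (auto simp: orthogonal_matrix_def)
  then have "\<exists>A. g ** A = mat 1 \<and> A ** g = mat 1"
    by blast
  then have inv: "g ** matrix_inv g = mat 1 \<and> matrix_inv g ** g = mat 1"
    unfolding matrix_inv_def by (rule someI_ex)
  then have "matrix_inv g = (transpose g ** g) ** matrix_inv g"
    by (simp only: * matrix_mul_lid)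
  also have "\<dots> = transpose g"
    using inv by (simp add: matrix_mul_assoc[symmetric])
  finally show ?thesis .
qed

lemma SO_transpose_mult [simp]:
  "g \<in> SO \<Longrightarrow> transpose g *v (g *v x) = x" "g \<in> SO \<Longrightarrow> g *v (transpose g *v x) = x"
  using SO_orthogonal[of g] by (auto simp: orthogonal_matrix_def matrix_vector_mul_assoc simp del: transpose_matrix_vector vector_transpose_matrix)

lemma rot_SO: "g \<in> SO \<Longrightarrow> rot g f = (\<lambda>x. f (transpose g *v x))"
  by (simp add: rot_def SO_matrix_inv)

section \<open>Rotations in coordinate planes and their generators\<close>

definition plane_rot :: "'n \<Rightarrow> 'n \<Rightarrow> real \<Rightarrow> real ^ 'n \<Rightarrow> real ^ 'n" where
  "plane_rot i j t x = x + ((cos t - 1) * x $ i - sin t * x $ j) *\<^sub>R axis i 1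
     + (sin t * x $ i + (cos t - 1) * x $ j) *\<^sub>R axis j 1"

lemma plane_rot_nth:
  assumes "i \<noteq> j"
  shows "plane_rot i j t x $ k = (if k = i then cos t * x $ i - sin t * x $ j
    else if k = j then sin t * x $ i + cos t * x $ j else x $ k)"
  using assms by (auto simp: plane_rot_def axis_def algebra_simps)

lemma linear_plane_rot: "linear (plane_rot i j t)"
  by (rule linearI) (auto simp: plane_rot_def vec_eq_iff axis_def algebra_simps)

lemma norm_plane_rot:
  assumes "i \<noteq> j" shows "norm (plane_rot i j t x) = norm x"
proof -
  have split: "(\<Sum>k\<in>UNIV. f k) = f i + f j + (\<Sum>k\<in>UNIV - {i,j}. f k)" for f :: "_ \<Rightarrow> real"
    using sum.subset_diff[of "{i,j}" UNIV f] assms by simp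
  have "(cos t * a - sin t * b)\<^sup>2 + (sin t * a + cos t * b)\<^sup>2 = a\<^sup>2 + b\<^sup>2" for a b
  proof -
    have "(cos t * a - sin t * b)\<^sup>2 + (sin t * a + cos t * b)\<^sup>2
      = ((sin t)\<^sup>2 + (cos t)\<^sup>2) * (a\<^sup>2 + b\<^sup>2)"
      by (simp only: power2_eq_square) (simp only: algebra_simps)
    then show ?thesis by (simp only: sin_cos_squared_add mult_1)
  qed
  then have "(plane_rot i j t x) \<bullet> (plane_rot i j t x) = x \<bullet> x"
    using assms by (simp add: inner_vec_def split[of "\<lambda>k. _ k * _ k"] plane_rot_nth power2_eq_square)
  then show ?thesis by (simp add: norm_eq_sqrt_inner)
qed

lemma plane_rot_add:
  assumes "i \<noteq> j" shows "plane_rot i j s (plane_rot i j t x) = plane_rot i j (s + t) x"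
  using assms by (auto simp: vec_eq_iff plane_rot_nth sin_add cos_add algebra_simps)

text \<open>The rotation is the square of the rotation by half the angle, whose determinant is 1 or
  -1; hence its own determinant is 1 and need not be expanded.\<close>

lemma plane_rot_SO:
  assumes "i \<noteq> j" shows "matrix (plane_rot i j t) \<in> SO"
proof -
  have orth: "orthogonal_matrix (matrix (plane_rot i j t))" for t
    using orthogonal_transformation_matrix[of "plane_rot i j t"] orthogonal_transformation[of "plane_rot i j t"]
      linear_plane_rot norm_plane_rot[OF assms] by blast
  have "matrix (plane_rot i j t) = matrix (plane_rot i j (t/2) \<circ> plane_rot i j (t/2))"
    by (simp add: plane_rot_add[OF assms] comp_def)
  also have "\<dots> = matrix (plane_rot i j (t/2)) ** matrix (plane_rot i j (t/2))"
    by (intro matrix_compose linear_plane_rot)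
  finally have "det (matrix (plane_rot i j t)) = (det (matrix (plane_rot i j (t/2))))\<^sup>2"
    by (simp add: det_mul power2_eq_square)
  also have "\<dots> = 1"
    using det_orthogonal_matrix[OF orth, of "t/2"] by auto
  finally show ?thesis
    using orth by (simp add: SO_def rotation_matrix_def)
qed

lemma plane_rot_matrix: "matrix (plane_rot i j t) *v x = plane_rot i j t x"
  by (simp add: linear_plane_rot)

text \<open>The angular momentum operator without its imaginary factor: the derivative at
  \<open>t = 0\<close> of \<open>p\<close> along the orbit \<open>plane_rot i j t x\<close>.\<close>

definition angular :: "'n \<Rightarrow> 'n \<Rightarrow> (real ^ 'n \<Rightarrow> complex) \<Rightarrow> real ^ 'n \<Rightarrow> complex" where
  "angular i j p x = complex_of_real (x $ i) * partial_derivative j p x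
     - complex_of_real (x $ j) * partial_derivative i p x"

lemma cpoly_angular: "cpoly p \<Longrightarrow> cpoly (angular i j p)"
  unfolding angular_def
  by (intro cpoly_diff cpoly_mult cpoly_coord cpoly_partial_derivative)

lemma has_vector_derivative_plane_rot:
  assumes "cpoly p" "i \<noteq> j"
  shows "((\<lambda>t. p (plane_rot i j t x)) has_vector_derivative angular i j p (plane_rot i j t x)) (at t)"
proof -
  define D where "D = (- sin t * x $ i - cos t * x $ j) *\<^sub>R axis i 1
     + (cos t * x $ i - sin t * x $ j) *\<^sub>R (axis j 1 :: real^'a)"
  have "((\<lambda>t. plane_rot i j t x) has_vector_derivative D) (at t)"
    unfolding plane_rot_def D_def
    by (auto intro!: derivative_eq_intros simp: has_vector_derivative_def algebra_simps)
  then have "((\<lambda>t. plane_rot i j t x) has_derivative (\<lambda>h. h *\<^sub>R D)) (at t)"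
    by (simp add: has_vector_derivative_def)
  from has_derivative_compose[OF this cpoly_has_derivative[OF assms(1)]]
  have "((\<lambda>t. p (plane_rot i j t x)) has_derivative
     (\<lambda>h. \<Sum>k\<in>UNIV. complex_of_real ((h *\<^sub>R D) $ k) * partial_derivative k p (plane_rot i j t x))) (at t)" .
  moreover have "(\<Sum>k\<in>UNIV. complex_of_real ((h *\<^sub>R D) $ k) * partial_derivative k p (plane_rot i j t x))
     = h *\<^sub>R angular i j p (plane_rot i j t x)" for h
  proof -
    \<comment> \<open>The velocity of the orbit is rewritten through the current point
      \<open>plane_rot i j t x\<close>, not the starting point. This is why the derivative at any
      time is again \<open>angular\<close>.\<close>
    have "D $ k = (if k = i then - (plane_rot i j t x $ j) else 0) + (if k = j then plane_rot i j t x $ i else 0)" for k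
      using assms(2) by (auto simp: D_def plane_rot_nth axis_def algebra_simps)
    then have "(\<Sum>k\<in>UNIV. complex_of_real ((h *\<^sub>R D) $ k) * partial_derivative k p (plane_rot i j t x))
      = (\<Sum>k\<in>UNIV. (if k = i then - of_real h * complex_of_real (plane_rot i j t x $ j) * partial_derivative i p (plane_rot i j t x) else 0)
           + (if k = j then of_real h * complex_of_real (plane_rot i j t x $ i) * partial_derivative j p (plane_rot i j t x) else 0))"
      using assms(2) by (intro sum.cong refl) auto
    then show ?thesis
      by (simp add: sum.distrib angular_def scaleR_conv_of_real algebra_simps)
  qed
  ultimately show ?thesis by (simp add: has_vector_derivative_def)
qed

section \<open>Integration against an invariant measure on the sphere\<close>

locale sphere_measure =
  fixes \<omega> :: "(real ^ 'n) measure"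
  assumes inv: "invariant_sphere_measure \<omega>"
begin

lemma sets_sphere: "sets \<omega> = sets (restrict_space borel (sphere 0 1))"
  using inv by (simp add: invariant_sphere_measure_def)

lemma space_sphere [simp]: "space \<omega> = sphere 0 1"
  using sets_eq_imp_space_eq[OF sets_sphere] by (simp add: space_restrict_space)

lemma emeasure_sphere: "emeasure \<omega> (space \<omega>) = 1"
  using inv by (simp add: invariant_sphere_measure_def del: mem_sphere_0)

sublocale finite_measure \<omega>
  by standard (simp only: emeasure_sphere, simp)

lemma measure_sphere [simp]: "measure \<omega> (sphere 0 1) = 1"
  using emeasure_sphere by (simp add: measure_def)

lemma measurable_continuous_on:
  "continuous_on (sphere 0 1) f \<Longrightarrow> (f :: _ \<Rightarrow> 'b::topological_space) \<in> borel_measurable \<omega>"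
  by (simp add: borel_measurable_continuous_on_restrict measurable_cong_sets[OF sets_sphere refl])

lemma integrable_continuous_on:
  assumes "continuous_on (sphere 0 1) f"
  shows "integrable \<omega> (f :: _ \<Rightarrow> 'b::{banach, second_countable_topology})"
proof -
  have "compact (f ` sphere 0 1)"
    using assms by (intro compact_continuous_image compact_sphere)
  then obtain B where "\<And>x. x \<in> sphere 0 1 \<Longrightarrow> norm (f x) \<le> B"
    by (meson bounded_iff compact_imp_bounded image_eqI)
  then show ?thesis
    by (intro integrable_const_bound[where B = B] measurable_continuous_on assms AE_I2) simp
qed

lemma measurable_SO: "h \<in> SO \<Longrightarrow> (\<lambda>x. h *v x) \<in> measurable \<omega> \<omega>"
  unfolding measurable_cong_sets[OF sets_sphere sets_sphere]
  by (intro measurable_restrict_space3)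
    (auto intro!: borel_measurable_continuous_onI linear_continuous_on linear_linear[THEN iffD2]
      simp: linear_linear)

lemma distr_SO: "h \<in> SO \<Longrightarrow> distr \<omega> \<omega> (\<lambda>x. h *v x) = \<omega>"
  using inv by (simp add: invariant_sphere_measure_def)

lemma integral_SO:
  fixes f :: "_ \<Rightarrow> 'b::{banach, second_countable_topology}"
  assumes "h \<in> SO" "f \<in> borel_measurable \<omega>"
  shows "(LINT x|\<omega>. f (h *v x)) = (LINT x|\<omega>. f x)"
  using integral_distr[OF measurable_SO[OF assms(1)] assms(2)] distr_SO[OF assms(1)] by simp

lemma integrable_cpoly: "cpoly p \<Longrightarrow> integrable \<omega> p"
  by (intro integrable_continuous_on cpoly_continuous_on)

text \<open>The angular derivatives are the infinitesimal generators of rotations, so the integral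
  of an angular derivative is the derivative of a constant.\<close>

lemma integral_angular:
  assumes p: "cpoly p" shows "(LINT x|\<omega>. angular i j p x) = 0"
proof (cases "i = j")
  case True
  then show ?thesis by (simp add: angular_def)
next
  case False
  have "compact (angular i j p ` sphere 0 1)"
    using cpoly_angular[OF p] by (intro compact_continuous_image compact_sphere cpoly_continuous_on)
  then obtain C where C: "\<And>x. norm x = 1 \<Longrightarrow> norm (angular i j p x) \<le> C"
    by (metis (no_types, lifting) bounded_iff compact_imp_bounded image_eqI mem_sphere_0)
  \<comment> \<open>Difference quotient of \<open>p\<close> along the orbit, with step
    \<open>1 / Suc k\<close>. Its mean is 0 by invariance, so only the passage to the limit under
    the integral remains.\<close>
  define s where "s k x = real (Suc k) *\<^sub>R (p (plane_rot i j (1 / real (Suc k)) x) - p x)" for k :: nat and x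
  have s_meas: "s k \<in> borel_measurable \<omega>" for k
  proof -
    have "cpoly (\<lambda>x. p (plane_rot i j (1 / real (Suc k)) x))"
      using cpoly_matrix_vector_mult[OF p, of "matrix (plane_rot i j (1 / real (Suc k)))"]
      by (simp add: plane_rot_matrix)
    then have "cpoly (s k)"
      unfolding s_def scaleR_conv_of_real by (intro cpoly_mult cpoly_const cpoly_diff p)
    then show ?thesis by (intro measurable_continuous_on cpoly_continuous_on)
  qed
  have lim: "(\<lambda>k. s k x) \<longlonglongrightarrow> angular i j p x" for x
  proof -
    have "((\<lambda>t. p (plane_rot i j t x)) has_vector_derivative angular i j p x) (at 0)"
      using has_vector_derivative_plane_rot[OF p False, of x 0] by (simp add: plane_rot_def)
    then have "((\<lambda>t. norm (p (plane_rot i j t x) - p x - t *\<^sub>R angular i j p x) / norm t) \<longlongrightarrow> 0) (at 0)"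
      by (simp add: has_vector_derivative_def has_derivative_at plane_rot_def)
    moreover have "filterlim (\<lambda>k. 1 / real (Suc k)) (at 0) sequentially"
      using LIMSEQ_inverse_real_of_nat by (intro filterlim_atI) (auto simp: divide_inverse)
    ultimately have "(\<lambda>k. norm (p (plane_rot i j (1 / real (Suc k)) x) - p x - (1 / real (Suc k)) *\<^sub>R angular i j p x)
        / norm (1 / real (Suc k))) \<longlonglongrightarrow> 0"
      by (rule filterlim_compose)
    also have "(\<lambda>k. norm (p (plane_rot i j (1 / real (Suc k)) x) - p x - (1 / real (Suc k)) *\<^sub>R angular i j p x)
        / norm (1 / real (Suc k))) = (\<lambda>k. norm (s k x - angular i j p x))"
    proof
      fix k :: nat
      have "s k x - angular i j p x = real (Suc k) *\<^sub>R
          (p (plane_rot i j (1 / real (Suc k)) x) - p x - (1 / real (Suc k)) *\<^sub>R angular i j p x)"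
        by (simp add: s_def scaleR_diff_right del: of_nat_Suc)
      then show "norm (p (plane_rot i j (1 / real (Suc k)) x) - p x - (1 / real (Suc k)) *\<^sub>R angular i j p x)
          / norm (1 / real (Suc k)) = norm (s k x - angular i j p x)"
        by (simp del: of_nat_Suc)
    qed
    finally show ?thesis
      by (simp only: tendsto_norm_zero_iff Lim_null[symmetric])
  qed
  \<comment> \<open>The mean value inequality compares the quotient with
    \<open>angular i j p\<close> at an intermediate point of the orbit. The orbit stays on the
    sphere, so the constant \<open>C\<close> dominates all quotients.\<close>
  have bound: "norm (s k x) \<le> C" if "norm x = 1" for k x
  proof -
    have "\<exists>t\<in>{0<..<1 / real (Suc k)}. norm (p (plane_rot i j (1 / real (Suc k)) x) - p (plane_rot i j 0 x))
       \<le> norm ((1 / real (Suc k) - 0) *\<^sub>R angular i j p (plane_rot i j t x))"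
      using has_vector_derivative_plane_rot[OF p False, of x, unfolded has_vector_derivative_def]
      by (intro mvt_general) (auto intro!: continuous_at_imp_continuous_on has_derivative_continuous)
    then obtain t where "norm (p (plane_rot i j (1 / real (Suc k)) x) - p x)
       \<le> (1 / real (Suc k)) * norm (angular i j p (plane_rot i j t x))"
      by (auto simp: plane_rot_def)
    also have "\<dots> \<le> (1 / real (Suc k)) * C"
      using C[of "plane_rot i j t x"] norm_plane_rot[OF False] that by (intro mult_left_mono) auto
    finally show ?thesis
      unfolding s_def norm_scaleR by (simp add: field_simps del: of_nat_Suc)
  qed
  have "(LINT x|\<omega>. s k x) = 0" for k
  proof -
    have "(LINT x|\<omega>. p (plane_rot i j (1 / real (Suc k)) x)) = (LINT x|\<omega>. p x)"
      using integral_SO[OF plane_rot_SO[OF False], of p "1 / real (Suc k)"] measurable_continuous_on[OF cpoly_continuous_on[OF p]]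
      by (simp add: plane_rot_matrix)
    moreover have "integrable \<omega> (\<lambda>x. p (plane_rot i j (1 / real (Suc k)) x))"
      using integrable_cpoly[OF cpoly_matrix_vector_mult[OF p, of "matrix (plane_rot i j (1 / real (Suc k)))"]]
      by (simp add: plane_rot_matrix)
    ultimately show ?thesis
      using integrable_cpoly[OF p] by (simp add: s_def)
  qed
  moreover have "(\<lambda>k. LINT x|\<omega>. s k x) \<longlonglongrightarrow> (LINT x|\<omega>. angular i j p x)"
    by (rule integral_dominated_convergence[where w = "\<lambda>_. C"])
      (auto intro!: s_meas lim bound measurable_continuous_on cpoly_continuous_on cpoly_angular p)
  ultimately show ?thesis
    by (simp add: LIMSEQ_const_iff)
qed

end

section \<open>Orthogonality of spherical harmonics of different degrees\<close>

lemma harmonicD: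
  assumes "harmonic_homogeneous_poly n p"
  shows "cpoly p" "p (t *\<^sub>R x) = of_real (t ^ n) * p x" "laplacian p x = 0"
  using assms by (auto simp: harmonic_homogeneous_poly_def polynomial_function_iff_cpoly)

lemma harmonicI:
  assumes "cpoly p" "\<And>t x. p (t *\<^sub>R x) = of_real (t ^ n) * p x" "\<And>x. laplacian p x = 0"
  shows "harmonic_homogeneous_poly n p"
  using assms by (auto simp: harmonic_homogeneous_poly_def polynomial_function_iff_cpoly)

text \<open>Both sides are the derivative of \<open>p (t *\<^sub>R x)\<close> at
  \<open>t = 1\<close>, once by the chain rule and once by homogeneity.\<close>

lemma euler_identity:
  fixes x :: "real ^ 'n"
  assumes p: "cpoly p" and hom: "\<And>t x. p (t *\<^sub>R x) = of_real (t ^ n) * p x"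
  shows "(\<Sum>i\<in>UNIV. complex_of_real (x $ i) * partial_derivative i p x) = of_nat n * p x"
proof -
  have "((\<lambda>t. t *\<^sub>R x) has_derivative (\<lambda>h. h *\<^sub>R x)) (at 1)"
    by (intro bounded_linear_imp_has_derivative bounded_linear_scaleR_left)
  from has_derivative_compose[OF this cpoly_has_derivative[OF p]]
  have "((\<lambda>t. p (t *\<^sub>R x)) has_derivative
     (\<lambda>h. h *\<^sub>R (\<Sum>i\<in>UNIV. complex_of_real (x $ i) * partial_derivative i p x))) (at 1)"
    by (simp add: scaleR_conv_of_real[where 'a=complex] sum_distrib_left mult.assoc)
  moreover have "((\<lambda>t. of_real (t ^ n) * p x) has_derivative (\<lambda>h. h *\<^sub>R (of_nat n * p x))) (at (1::real))"
    by (auto intro!: derivative_eq_intros simp: scaleR_conv_of_real[where 'a=complex])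
  ultimately show ?thesis
    using vector_derivative_unique_at[of "\<lambda>t. p (t *\<^sub>R x)"]
    by (simp add: has_vector_derivative_def hom)
qed

text \<open>Euler's identity is differentiated in the \<open>j\<close>-th coordinate; the term from
  differentiating the factor \<open>x $ j\<close> moves to the right. The subtraction is complex, so
  \<open>n = 0\<close> gives \<open>-1\<close> and is not truncated.\<close>

lemma euler_identity_partial:
  fixes x :: "real ^ 'n"
  assumes p: "cpoly p" and hom: "\<And>t x. p (t *\<^sub>R x) = of_real (t ^ n) * p x"
  shows "(\<Sum>i\<in>UNIV. complex_of_real (x $ i) * partial_derivative j (partial_derivative i p) x)
    = (of_nat n - 1) * partial_derivative j p x"
proof -
  have "(\<lambda>x. \<Sum>i\<in>UNIV. complex_of_real (x $ i) * partial_derivative i p x) = (\<lambda>x. of_nat n * p x)"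
    using euler_identity[OF p hom] by blast
  then have "partial_derivative j (\<lambda>x. \<Sum>i\<in>UNIV. complex_of_real (x $ i) * partial_derivative i p x) x
      = partial_derivative j (\<lambda>x. of_nat n * p x) x"
    by simp
  also have "partial_derivative j (\<lambda>x. \<Sum>i\<in>UNIV. complex_of_real (x $ i) * partial_derivative i p x) x
    = (\<Sum>i\<in>UNIV. complex_of_real (x $ i) * partial_derivative j (partial_derivative i p) x
       + (if j = i then partial_derivative i p x else 0))"
    by (simp add: partial_derivative_sum partial_derivative_mult cpoly_mult cpoly_coord cpoly_partial_derivative p
        if_distrib[of "\<lambda>c. c * _"] cong: if_cong)
  finally show ?thesis
    by (simp add: sum.distrib partial_derivative_cmult p algebra_simps)
qed

text \<open>The sum runs over ordered pairs, so it is twice the Casimir operator of the rotation group.\<close>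

lemma sum_angular_angular:
  fixes p :: "real ^ 'n \<Rightarrow> complex"
  assumes "harmonic_homogeneous_poly n p"
  shows "(\<Sum>i\<in>UNIV. \<Sum>j\<in>UNIV. angular i j (angular i j p) x)
    = - 2 * of_nat n * (of_nat n + of_nat CARD('n) - 2) * p x"
proof -
  note p = harmonicD(1)[OF assms] and hom = harmonicD(2)[OF assms]
  let ?P = "\<lambda>a. partial_derivative a p x" and ?Q = "\<lambda>a b. partial_derivative a (partial_derivative b p) x"
  let ?x = "\<lambda>i. complex_of_real (x $ i)" and ?E = "of_nat n * p x"
  \<comment> \<open>After summation the terms with an unmixed second derivative vanish by
    harmonicity, and all others are of Euler type. With \<open>d = CARD('n)\<close> they add up to
    \<open>2 - 2 * d - 2 * (n - 1)\<close> times \<open>of_nat n * p x\<close>.\<close>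
  have 1: "angular i j (angular i j p) x =
      (if i = j then ?x i * ?P j + ?x j * ?P i else 0) + ?x i * ?x i * ?Q j j + ?x j * ?x j * ?Q i i
      - ?x i * ?P i - ?x j * ?P j - ?x i * (?x j * ?Q j i) - ?x j * (?x i * ?Q i j)" for i j
  proof -
    have *: "partial_derivative k (angular i j p) x =
       (if k = i then ?P j else 0) + ?x i * ?Q k j - (if k = j then ?P i else 0) - ?x j * ?Q k i" for k
      unfolding angular_def
      by (simp add: partial_derivative_diff partial_derivative_mult cpoly_mult cpoly_coord cpoly_partial_derivative p)
    show ?thesis
      unfolding angular_def[of i j "angular i j p"] * by (simp add: algebra_simps)
  qed
  have E: "(\<Sum>i\<in>UNIV. ?x i * ?P i) = ?E"
    by (rule euler_identity[OF p hom])
  have E2: "(\<Sum>j\<in>UNIV. ?x j * ?Q i j) = (of_nat n - 1) * ?P i" for i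
    by (rule euler_identity_partial[OF p hom])
  have L: "(\<Sum>i\<in>UNIV. ?Q i i) = 0"
    using harmonicD(3)[OF assms, of x] by (simp add: laplacian_def)
  have A: "(\<Sum>i\<in>UNIV. \<Sum>j\<in>UNIV. if i = j then ?x i * ?P j + ?x j * ?P i else 0) = 2 * ?E"
  proof -
    have "(\<Sum>i\<in>UNIV. \<Sum>j\<in>UNIV. if i = j then ?x i * ?P j + ?x j * ?P i else 0)
      = (\<Sum>i\<in>UNIV. 2 * (?x i * ?P i))"
      by (intro sum.cong refl) simp
    then show ?thesis by (simp only: sum_distrib_left[symmetric] E)
  qed
  have B: "(\<Sum>i\<in>UNIV. \<Sum>j\<in>UNIV. ?x i * ?x i * ?Q j j) = 0"
    by (simp add: sum_distrib_left[symmetric] L)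
  have B': "(\<Sum>i\<in>UNIV. \<Sum>j\<in>UNIV. ?x j * ?x j * ?Q i i) = 0"
    by (subst sum.swap) (rule B)
  have C: "(\<Sum>i\<in>UNIV. \<Sum>j\<in>(UNIV::'n set). ?x i * ?P i) = of_nat CARD('n) * ?E"
    by (simp add: sum_distrib_left[symmetric] E)
  have C': "(\<Sum>i\<in>(UNIV::'n set). \<Sum>j\<in>UNIV. ?x j * ?P j) = of_nat CARD('n) * ?E"
    by (simp add: E)
  have D': "(\<Sum>i\<in>UNIV. \<Sum>j\<in>UNIV. ?x i * (?x j * ?Q i j)) = (of_nat n - 1) * ?E"
    by (simp only: sum_distrib_left[symmetric] E2 mult.left_commute[of _ "of_nat n - 1"] E)
  have D: "(\<Sum>i\<in>UNIV. \<Sum>j\<in>UNIV. ?x i * (?x j * ?Q j i)) = (of_nat n - 1) * ?E"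
    using D' by (simp only: partial_derivative_commute[OF p])
  have D'': "(\<Sum>i\<in>UNIV. \<Sum>j\<in>UNIV. ?x j * (?x i * ?Q i j)) = (of_nat n - 1) * ?E"
    using D' by (simp only: mult.left_commute)
  show ?thesis
    unfolding 1 sum.distrib sum_subtractf A B B' C C' D D'' by (simp add: algebra_simps)
qed

lemma angular_mult:
  "cpoly p \<Longrightarrow> cpoly q \<Longrightarrow>
    angular i j (\<lambda>x. p x * q x) = (\<lambda>x. p x * angular i j q x + angular i j p x * q x)"
  by (simp add: fun_eq_iff angular_def partial_derivative_mult algebra_simps)

lemma angular_diff:
  "cpoly p \<Longrightarrow> cpoly q \<Longrightarrow> angular i j (\<lambda>x. p x - q x) = (\<lambda>x. angular i j p x - angular i j q x)"
  by (simp add: fun_eq_iff angular_def partial_derivative_diff algebra_simps)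

context sphere_measure
begin

text \<open>This is Green's second identity with rotation generators:
  \<open>p * L (L q) - q * L (L p)\<close> equals \<open>L (p * L q - q * L p)\<close> and so has
  mean 0. Summed over all planes, it multiplies the integral by the difference of two
  eigenvalues.\<close>

lemma integral_harmonic_mult:
  assumes p: "harmonic_homogeneous_poly m p" and q: "harmonic_homogeneous_poly n q"
    and "m \<noteq> n" and d: "CARD('n) \<ge> 2"
  shows "(LINT x|\<omega>. p x * q x) = 0"
proof -
  note cp = harmonicD(1)[OF p] and cq = harmonicD(1)[OF q]
  let ?l = "\<lambda>n. of_nat n * (of_nat n + of_nat CARD('n) - 2) :: complex"
  have ang: "angular i j (\<lambda>x. p x * angular i j q x - q x * angular i j p x)
     = (\<lambda>x. p x * angular i j (angular i j q) x - q x * angular i j (angular i j p) x)" for i j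
    by (simp add: angular_diff angular_mult cpoly_mult cpoly_angular cp cq algebra_simps)
  have I: "integrable \<omega> (\<lambda>x. p x * angular i j (angular i j q) x - q x * angular i j (angular i j p) x)" for i j
    by (intro integrable_cpoly cpoly_diff cpoly_mult cpoly_angular cp cq)
  have "(LINT x|\<omega>. p x * angular i j (angular i j q) x - q x * angular i j (angular i j p) x) = 0" for i j
    using integral_angular[OF cpoly_diff[OF cpoly_mult[OF cp cpoly_angular[OF cq]]
        cpoly_mult[OF cq cpoly_angular[OF cp]]], of i j i j i j]
    by (simp only: ang)
  then have "0 = (\<Sum>i\<in>UNIV. \<Sum>j\<in>UNIV. (LINT x|\<omega>. p x * angular i j (angular i j q) x - q x * angular i j (angular i j p) x))"
    by simp
  also have "\<dots> = (LINT x|\<omega>. (\<Sum>i\<in>UNIV. \<Sum>j\<in>UNIV. p x * angular i j (angular i j q) x - q x * angular i j (angular i j p) x))"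
    by (simp add: Bochner_Integration.integral_sum I Bochner_Integration.integrable_sum)
  also have "\<dots> = (LINT x|\<omega>. (2 * (?l m - ?l n)) * (p x * q x))"
    by (intro Bochner_Integration.integral_cong refl)
      (simp only: sum_subtractf sum_distrib_left[symmetric] sum_angular_angular[OF p] sum_angular_angular[OF q],
       simp add: algebra_simps)
  also have "\<dots> = (2 * (?l m - ?l n)) * (LINT x|\<omega>. p x * q x)"
    by simp
  finally have "?l m = ?l n \<or> (LINT x|\<omega>. p x * q x) = 0" by auto
  moreover have "?l m \<noteq> ?l n"
  proof
    assume "?l m = ?l n"
    \<comment> \<open>Writing the dimension as \<open>k + 2\<close> turns the eigenvalue into the
      natural number \<open>n * (n + k)\<close>, which is strictly increasing in
      \<open>n\<close>.\<close>
    obtain k where "CARD('n) = k + 2"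
      using d by (metis le_Suc_ex add.commute)
    then have "complex_of_nat (m * (m + k)) = of_nat (n * (n + k))"
      using \<open>?l m = ?l n\<close> by simp
    then have eq: "m * (m + k) = n * (n + k)"
      by (simp only: of_nat_eq_iff)
    have "a * (a + k) < b * (b + k)" if "a < b" for a b :: nat
      using that by (intro mult_strict_mono) auto
    then show False
      using eq \<open>m \<noteq> n\<close> by (metis nat_neq_iff)
  qed
  ultimately show ?thesis by blast
qed

end

section \<open>Two-point transitivity of the rotation group\<close>

text \<open>Reflection in the hyperplane orthogonal to \<open>v\<close>. For \<open>v = 0\<close> it
  is the identity, so points that already coincide need no separate treatment when it is used to
  move one to the other.\<close>

definition householder :: "'a \<Rightarrow> 'a \<Rightarrow> 'a::real_inner" where
  "householder v x = x - (2 * (v \<bullet> x) / (v \<bullet> v)) *\<^sub>R v"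

lemma linear_householder: "linear (householder v)"
  by (rule linearI) (simp_all add: householder_def inner_right_distrib add_divide_distrib distrib_left algebra_simps)

lemma householder_eq_self: "v \<bullet> x = 0 \<Longrightarrow> householder v x = x"
  by (simp add: householder_def)

lemma norm_householder: "norm (householder v x) = norm x"
proof -
  have "(householder v x) \<bullet> (householder v x) = x \<bullet> x"
    by (cases "v = 0") (simp_all add: householder_def inner_diff_left inner_diff_right inner_commute field_simps power2_eq_square)
  then show ?thesis by (simp add: norm_eq_sqrt_inner)
qed

lemma orthogonal_transformation_householder: "orthogonal_transformation (householder v)"
  by (simp add: orthogonal_transformation linear_householder norm_householder)

lemma householder_swap:
  assumes "norm x = norm y" shows "householder (x - y) x = y"
proof (cases "x = y")
  case False
  have "x \<bullet> x = y \<bullet> y" using assms by (simp add: norm_eq)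
  \<comment> \<open>Equality of the norms makes the coefficient in the reflection equal to 1, so
    exactly \<open>x - y\<close> is subtracted from \<open>x\<close>.\<close>
  then have *: "2 * ((x - y) \<bullet> x) = (x - y) \<bullet> (x - y)"
    by (simp add: inner_diff_left inner_diff_right inner_commute)
  moreover have "(x - y) \<bullet> (x - y) \<noteq> 0" using False by simp
  ultimately show ?thesis unfolding householder_def * by simp
qed (simp add: householder_def)

text \<open>A rotation that carries a coordinate axis to the unit normal conjugates the reflection
  into a diagonal matrix with a single entry -1 and all others 1.\<close>

lemma det_householder:
  fixes n :: "real ^ 'n"
  assumes "n \<noteq> 0" "CARD('n) \<ge> 2"
  shows "det (matrix (householder n)) = -1"
proof -
  define a where "a = n /\<^sub>R norm n"
  have a: "norm a = 1" using assms by (simp add: a_def)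
  have aa: "a \<bullet> a = 1" using a by (simp add: norm_eq_1)
  have Hn: "householder n = householder a"
  proof
    fix x
    have "n = norm n *\<^sub>R a" using assms by (simp add: a_def)
    then obtain c where c: "n = c *\<^sub>R a" "c \<noteq> 0" using assms by fastforce
    show "householder n x = householder a x"
      using c by (simp add: householder_def aa)
  qed
  fix k :: 'n
  obtain A where A: "rotation_matrix A" "A *v (axis k 1) = a"
    using rotation_matrix_exists_basis[OF assms(2) a] by metis
  then have SO: "A \<in> SO" by (simp add: SO_def)
  have "householder a \<circ> (*v) A = (*v) A \<circ> householder (axis k 1)"
  proof
    fix x
    have "a \<bullet> (A *v x) = axis k 1 \<bullet> x"
      using SO_inner[OF SO, of "axis k 1" x] A by simp
    then show "(householder a \<circ> (*v) A) x = ((*v) A \<circ> householder (axis k 1)) x"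
      using A(2) by (simp add: householder_def aa matrix_vector_mult_diff_distrib
          linear_scale[OF matrix_vector_mul_linear] inner_axis_axis)
  qed
  then have "matrix (householder a) ** A = A ** matrix (householder (axis k 1))"
    by (metis matrix_compose matrix_of_matrix_vector_mul linear_householder matrix_vector_mul_linear)
  then have "det (matrix (householder a)) * det A = det A * det (matrix (householder (axis k 1)) :: real^'n^'n)"
    by (metis det_mul)
  moreover have "det A = 1" using A by (simp add: rotation_matrix_def)
  moreover have "det (matrix (householder (axis k 1)) :: real^'n^'n) = -1"
  proof -
    have e: "matrix (householder (axis k 1)) $ i $ j = (if i = j then if i = k then -1 else 1 else (0::real))" for i j :: 'n
      by (simp add: matrix_def householder_def inner_axis_axis) (auto simp: axis_def)
    then have "det (matrix (householder (axis k 1)) :: real^'n^'n) = (\<Prod>i\<in>UNIV. if i = k then -1 else 1)"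
      by (subst det_diagonal) auto
    then show ?thesis by (simp add: prod.delta)
  qed
  ultimately show ?thesis by (simp add: Hn)
qed

text \<open>One reflection moves \<open>x\<close> to \<open>x'\<close>, a second moves the image of
  \<open>y\<close> to \<open>y'\<close>; the second fixes \<open>x'\<close> because the inner
  products agree. If the resulting determinant is -1, a further reflection is added whose mirror
  contains \<open>x'\<close> and \<open>y'\<close>. Its normal exists because two vectors do not
  span a space of dimension at least 3.\<close>

lemma SO_two_point_transitive:
  fixes x y x' y' :: "real ^ 'n"
  assumes d: "CARD('n) \<ge> 3" and "norm x = norm x'" "norm y = norm y'" "x \<bullet> y = x' \<bullet> y'"
  obtains h where "h \<in> SO" "h *v x = x'" "h *v y = y'"
proof -
  define y1 where "y1 = householder (x - x') y"
  define T where "T = householder (y1 - y') \<circ> householder (x - x')"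
  have T: "orthogonal_transformation T"
    unfolding T_def by (intro orthogonal_transformation_compose orthogonal_transformation_householder)
  have x1: "householder (x - x') x = x'"
    by (rule householder_swap) fact
  have "x' \<bullet> y1 = x \<bullet> y"
    using orthogonal_transformation_householder[of "x - x'"] x1 unfolding y1_def orthogonal_transformation_def by metis
  then have Tx: "T x = x'"
    by (simp add: T_def x1, intro householder_eq_self)
      (simp add: inner_diff_left inner_diff_right inner_commute assms(4))
  have Ty: "T y = y'"
    using assms(3) by (simp add: T_def y1_def[symmetric]) (simp add: householder_swap y1_def norm_householder)
  have lT: "linear T" using T by (simp add: orthogonal_transformation_def)
  consider "det (matrix T) = 1" | "det (matrix T) = -1"
    using det_orthogonal_matrix[of "matrix T"] T by (auto simp: orthogonal_transformation_matrix)
  then show ?thesis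
  proof cases
    case 1
    then have "matrix T \<in> SO"
      using T by (simp add: SO_def rotation_matrix_def orthogonal_transformation_matrix)
    then show ?thesis using that[of "matrix T"] Tx Ty lT by simp
  next
    case 2
    have "dim {x', y'} \<le> card {x', y'}" by (intro dim_le_card') simp
    also have "\<dots> \<le> 2" by (cases "x' = y'") auto
    finally have "dim {x', y'} < DIM(real ^ 'n)" using d by simp
    then obtain n where n: "n \<noteq> 0" "\<And>z. z \<in> span {x', y'} \<Longrightarrow> orthogonal n z"
      using orthogonal_to_subspace_exists by metis
    have "n \<bullet> x' = 0" "n \<bullet> y' = 0" using n(2)[of x'] n(2)[of y'] by (auto simp: orthogonal_def span_base)
    then have fixed: "householder n x' = x'" "householder n y' = y'"
      by (simp_all add: householder_eq_self)
    define S where "S = householder n \<circ> T"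
    have S: "orthogonal_transformation S"
      unfolding S_def by (intro orthogonal_transformation_compose orthogonal_transformation_householder T)
    have "det (matrix S) = 1"
      using det_householder[OF n(1)] 2 d
      by (simp add: S_def matrix_compose lT linear_householder det_mul)
    then have "matrix S \<in> SO"
      using S by (simp add: SO_def rotation_matrix_def orthogonal_transformation_matrix)
    moreover have "linear S" using S by (simp add: orthogonal_transformation_def)
    ultimately show ?thesis using that[of "matrix S"] fixed Tx Ty by (simp add: S_def)
  qed
qed

lemma SO_transitive:
  fixes x x' :: "real ^ 'n"
  assumes "CARD('n) \<ge> 3" "norm x = norm x'"
  obtains h where "h \<in> SO" "h *v x = x'"
  using SO_two_point_transitive[OF assms(1), of x x' x x'] assms(2) by (metis norm_eq)

section \<open>Zonal harmonics\<close>

lemma harmonic_SO: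
  assumes "harmonic_homogeneous_poly n p" "g \<in> SO"
  shows "harmonic_homogeneous_poly n (\<lambda>x. p (g *v x))"
  using harmonicD[OF assms(1)]
  by (intro harmonicI)
    (simp_all add: cpoly_matrix_vector_mult laplacian_orthogonal SO_orthogonal assms(2)
      linear_scale[OF matrix_vector_mul_linear])

lemma harmonic_cnj:
  assumes "harmonic_homogeneous_poly n p"
  shows "harmonic_homogeneous_poly n (\<lambda>x. cnj (p x))"
proof (rule harmonicI)
  note p = harmonicD[OF assms]
  show "laplacian (\<lambda>x. cnj (p x)) x = 0" for x
  proof -
    have "laplacian (\<lambda>x. cnj (p x)) x = cnj (laplacian p x)"
      by (simp add: laplacian_def partial_derivative_cnj p cpoly_partial_derivative)
    then show ?thesis by (simp add: p)
  qed
  show "cpoly (\<lambda>x. cnj (p x))" by (intro cpoly_cnj p)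
  show "cnj (p (t *\<^sub>R x)) = of_real (t ^ n) * cnj (p x)" for t x
    by (simp add: p(2))
qed

lemma harmonic_add:
  assumes "harmonic_homogeneous_poly n p" "harmonic_homogeneous_poly n q"
  shows "harmonic_homogeneous_poly n (\<lambda>x. p x + q x)"
proof -
  note p = harmonicD[OF assms(1)] and q = harmonicD[OF assms(2)]
  have "laplacian (\<lambda>x. p x + q x) x = laplacian p x + laplacian q x" for x
    by (simp add: laplacian_def partial_derivative_add p(1) q(1) cpoly_partial_derivative sum.distrib)
  then show ?thesis
    by (intro harmonicI) (simp_all add: p(2,3) q(2,3) cpoly_add p(1) q(1) algebra_simps)
qed

lemma harmonic_cmult:
  assumes "harmonic_homogeneous_poly n p"
  shows "harmonic_homogeneous_poly n (\<lambda>x. c * p x)"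
proof -
  note p = harmonicD[OF assms(1)]
  have "laplacian (\<lambda>x. c * p x) x = c * laplacian p x" for x
    by (simp add: laplacian_def partial_derivative_cmult p(1) cpoly_partial_derivative sum_distrib_left)
  then show ?thesis
    by (intro harmonicI) (simp_all add: p(2,3) cpoly_mult cpoly_const p(1) algebra_simps)
qed

lemma harmonic_const: "harmonic_homogeneous_poly 0 (\<lambda>x. c)"
  by (intro harmonicI) (simp_all add: cpoly_const laplacian_def)

lemma harmonic_partial_derivative:
  assumes "harmonic_homogeneous_poly (Suc n) p"
  shows "harmonic_homogeneous_poly n (partial_derivative i p)"
proof (rule harmonicI)
  note p = harmonicD[OF assms]
  show q: "cpoly (partial_derivative i p)" by (intro cpoly_partial_derivative p)
  have "laplacian p = (\<lambda>x. 0)" using p(3) by blast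
  then show "laplacian (partial_derivative i p) x = 0" for x
    by (simp add: laplacian_partial_derivative p(1))
  show "partial_derivative i p (t *\<^sub>R x) = of_real (t ^ n) * partial_derivative i p x" for t x
  proof -
    \<comment> \<open>Differentiating the homogeneity of \<open>p\<close> leaves a factor
      \<open>t\<close> to cancel, so \<open>t = 0\<close> has to be reached by continuity. There
      \<open>0 ^ n\<close> is 1 for \<open>n = 0\<close>, in accordance with the limit.\<close>
    have *: "partial_derivative i p (t *\<^sub>R x) = of_real (t ^ n) * partial_derivative i p x" if "t \<noteq> 0" for t
    proof -
      have "(\<lambda>x. p (t *\<^sub>R x)) = (\<lambda>x. of_real (t ^ Suc n) * p x)"
        using p(2) by blast
      then have "of_real t * partial_derivative i p (t *\<^sub>R x) = of_real (t ^ Suc n) * partial_derivative i p x"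
        using partial_derivative_scaleR[OF p(1), of i t] partial_derivative_cmult[OF p(1), of i "of_real (t ^ Suc n)"]
        by metis
      then show ?thesis using that by simp
    qed
    show ?thesis
    proof (cases "t = 0")
      case True
      have "continuous_on UNIV (\<lambda>t. partial_derivative i p (t *\<^sub>R x))"
        by (rule continuous_on_compose2[OF cpoly_continuous_on[OF q, of UNIV]]) (intro continuous_intros, simp)
      then have "isCont (\<lambda>t. partial_derivative i p (t *\<^sub>R x)) 0"
        by (simp only: continuous_on_eq_continuous_at open_UNIV) blast
      then have 1: "((\<lambda>t. partial_derivative i p (t *\<^sub>R x)) \<longlongrightarrow> partial_derivative i p (0 *\<^sub>R x)) (at 0)"
        by (simp add: isCont_def)
      have 2: "((\<lambda>t. of_real (t ^ n) * partial_derivative i p x) \<longlongrightarrow> of_real (0 ^ n) * partial_derivative i p x) (at (0::real))"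
        by (intro tendsto_intros)
      have "eventually (\<lambda>t. of_real (t ^ n) * partial_derivative i p x = partial_derivative i p (t *\<^sub>R x)) (at (0::real))"
        using * by (auto simp: eventually_at_filter)
      then have "((\<lambda>t. partial_derivative i p (t *\<^sub>R x)) \<longlongrightarrow> of_real (0 ^ n) * partial_derivative i p x) (at (0::real))"
        using 2 by (rule Lim_transform_eventually[rotated])
      from tendsto_unique[OF _ 1 this] True show ?thesis by simp
    qed (rule *)
  qed
qed

text \<open>The vector with entries 1 and \<open>\<i>\<close> is isotropic, i.e. the sum of its
  squared entries is 0, and the Laplacian of a power of the linear form has this sum as a factor.
  These polynomials show that no degree is empty.\<close>

lemma harmonic_power:
  fixes i j :: "'n::finite"
  assumes "i \<noteq> j"
  shows "harmonic_homogeneous_poly n (\<lambda>x. (complex_of_real (x $ i) + \<i> * complex_of_real (x $ j)) ^ n)"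
proof (rule harmonicI)
  define q where "q x = complex_of_real (x $ i) + \<i> * complex_of_real (x $ j)" for x :: "real ^ 'n"
  define c where "c a = (if a = i then 1 else if a = j then \<i> else 0 :: complex)" for a
  have q: "cpoly q" unfolding q_def by (intro cpoly_add cpoly_mult cpoly_const cpoly_coord)
  have dq: "partial_derivative a q = (\<lambda>x. c a)" for a
    unfolding q_def using assms
    by (simp add: partial_derivative_add partial_derivative_cmult cpoly_mult cpoly_const cpoly_coord c_def fun_eq_iff)
  have dqn: "partial_derivative a (\<lambda>x. q x ^ n) = (\<lambda>x. of_nat n * c a * q x ^ (n - 1))" for a n
  proof (induction n)
    case (Suc n)
    have "of_nat n * c a * (q x * q x ^ (n - 1)) = of_nat n * c a * q x ^ n" for x
      by (cases n) auto
    then show ?case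
      by (simp add: partial_derivative_mult q cpoly_power dq Suc fun_eq_iff algebra_simps)
  qed simp
  have c2: "(\<Sum>a\<in>UNIV. c a * c a) = 0"
  proof -
    have "c a * c a = (if a = i then 1 else 0) + (if a = j then -1 else 0)" for a
      using assms by (simp add: c_def)
    then show ?thesis by (simp add: sum.distrib)
  qed
  have "laplacian (\<lambda>x. q x ^ n) x = (\<Sum>a\<in>UNIV. (c a * c a) * (of_nat n * of_nat (n - 1) * q x ^ (n - 1 - 1)))" for x
    unfolding laplacian_def dqn partial_derivative_cmult[OF cpoly_power[OF q]]
    by (simp add: algebra_simps)
  then have "laplacian (\<lambda>x. q x ^ n) x = 0" for x
    by (simp only: sum_distrib_right[symmetric] c2 mult_zero_left)
  then show "laplacian (\<lambda>x. (complex_of_real (x $ i) + \<i> * complex_of_real (x $ j)) ^ n) x = 0" for x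
    by (simp add: q_def)
  show "cpoly (\<lambda>x. (complex_of_real (x $ i) + \<i> * complex_of_real (x $ j)) ^ n)"
    using cpoly_power[OF q] by (simp add: q_def)
  show "(complex_of_real ((t *\<^sub>R x) $ i) + \<i> * complex_of_real ((t *\<^sub>R x) $ j)) ^ n
    = of_real (t ^ n) * (complex_of_real (x $ i) + \<i> * complex_of_real (x $ j)) ^ n" for t x
    by (simp add: power_mult_distrib[symmetric] algebra_simps)
qed

context sphere_measure
begin

text \<open>If the measure sat on the two poles of axis \<open>k\<close>, a rotation of axis
  \<open>j\<close> to axis \<open>k\<close> would give both squared coordinates the mean 1. Their
  sum is at most 1 on the sphere.\<close>

lemma not_AE_coord_sq_eq_one:
  fixes k :: 'n
  assumes d: "CARD('n) \<ge> 3"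
  shows "\<not> (AE x in \<omega>. (x $ k)\<^sup>2 = 1)"
proof
  assume AE: "AE x in \<omega>. (x $ k)\<^sup>2 = 1"
  have meas: "(\<lambda>x. (x $ i)\<^sup>2) \<in> borel_measurable \<omega>" and int: "integrable \<omega> (\<lambda>x. (x $ i)\<^sup>2)" for i :: 'n
    by (auto intro!: measurable_continuous_on integrable_continuous_on continuous_intros)
  have k: "(LINT x|\<omega>. (x $ k)\<^sup>2) = 1"
    using integral_cong_AE[OF meas _ AE] by simp
  obtain j where j: "j \<noteq> k"
    using exists_distinct_index[of k] d by force
  obtain h where h: "h \<in> SO" "h *v axis j 1 = axis k 1"
    using SO_transitive[OF d, of "axis j 1" "axis k 1"] by (auto simp: norm_axis_1)
  have "(h *v x) $ k = x $ j" for x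
    using SO_inner[OF h(1), of x "axis j 1"] by (simp add: h(2) inner_axis)
  then have "(LINT x|\<omega>. (x $ j)\<^sup>2) = 1"
    using integral_SO[OF h(1) meas[of k]] k by simp
  then have "(LINT x|\<omega>. (x $ k)\<^sup>2 + (x $ j)\<^sup>2) = 2"
    using k int by simp
  moreover have "(LINT x|\<omega>. (x $ k)\<^sup>2 + (x $ j)\<^sup>2) \<le> (LINT x|\<omega>. 1)"
  proof (intro integral_mono)
    fix x assume "x \<in> space \<omega>"
    then have "x \<bullet> x = 1" by (simp add: norm_eq_1)
    moreover have "(\<Sum>i\<in>{k, j}. x $ i * x $ i) \<le> (\<Sum>i\<in>UNIV. x $ i * x $ i)"
      by (intro sum_mono2) auto
    ultimately show "(x $ k)\<^sup>2 + (x $ j)\<^sup>2 \<le> 1"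
      using j by (simp add: inner_vec_def power2_eq_square)
  qed (auto intro: int)
  ultimately show False by simp
qed

text \<open>Induction on the degree: the derivative in the direction of the pole is again zonal and,
  by Euler's identity, again vanishes at the pole. So \<open>p\<close> does not depend on the coordinate along
  the pole, which leaves a multiple of a power of the distance to the axis; its mean is \<open>0\<close>.\<close>

lemma zonal_harmonic_eq_zero:
  fixes k :: 'n
  assumes d: "CARD('n) \<ge> 3"
    and "harmonic_homogeneous_poly n p"
    and "\<And>h x. h \<in> SO \<Longrightarrow> h *v axis k 1 = axis k 1 \<Longrightarrow> p (h *v x) = p x"
    and "p (axis k 1) = 0"
  shows "p x = 0"
  using assms(2-)
proof (induction n arbitrary: p x)
  case 0
  show ?case
    using harmonicD(2)[OF 0(1), of 0 x] harmonicD(2)[OF 0(1), of 0 "axis k 1"] 0(3) by simp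
next
  case (Suc n)
  note p = harmonicD[OF Suc.prems(1)]
  let ?e = "axis k 1 :: real ^ 'n"
  define q where "q = partial_derivative k p"
  have sum_e: "(\<Sum>i\<in>UNIV. complex_of_real ((t *\<^sub>R ?e) $ i) * partial_derivative i p y) = t *\<^sub>R q y" for t y
  proof -
    have "(\<Sum>i\<in>UNIV. complex_of_real ((t *\<^sub>R ?e) $ i) * partial_derivative i p y)
        = (\<Sum>i\<in>UNIV. if i = k then of_real t * q y else 0)"
      by (intro sum.cong refl) (auto simp: axis_def q_def)
    then show ?thesis by (simp add: scaleR_conv_of_real)
  qed
  have q: "q y = 0" for y
  proof (rule Suc.IH)
    show "harmonic_homogeneous_poly n q"
      unfolding q_def by (intro harmonic_partial_derivative Suc.prems)
    show "q (h *v x) = q x" if h: "h \<in> SO" "h *v ?e = ?e" for h x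
    proof -
      \<comment> \<open>A rotation that fixes the pole has the pole as its \<open>k\<close>-th
        column, so the chain rule for the derivative along axis \<open>k\<close> keeps a single
        term.\<close>
      have hk: "h $ l $ k = (if l = k then 1 else 0)" for l
        using arg_cong[OF h(2), of "\<lambda>v. v $ l"]
        by (simp add: matrix_vector_mul_component inner_axis) (simp add: axis_def)
      then have "partial_derivative k (\<lambda>x. p (h *v x)) x = partial_derivative k p (h *v x)"
        by (simp only: partial_derivative_linear_image[OF p(1)] hk)
          (simp add: if_distrib if_distribR cong: if_cong)
      moreover have "(\<lambda>x. p (h *v x)) = p"
        using Suc.prems(2)[OF h] by blast
      ultimately show ?thesis by (simp add: q_def)
    qed
    have "(\<Sum>i\<in>UNIV. complex_of_real (?e $ i) * partial_derivative i p ?e) = of_nat (Suc n) * p ?e"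
      by (rule euler_identity[OF p(1,2)])
    then show "q ?e = 0"
      using sum_e[of 1 ?e] by (simp add: Suc.prems(3))
  qed
  then have shift: "p (x + t *\<^sub>R ?e) = p x" for x t
  proof -
    have "((\<lambda>t. p (x + t *\<^sub>R ?e)) has_vector_derivative 0) (at t within UNIV)" for t
    proof -
      have "((\<lambda>t. x + t *\<^sub>R ?e) has_derivative (\<lambda>h. h *\<^sub>R ?e)) (at t)"
        by (auto intro!: derivative_eq_intros)
      from has_derivative_compose[OF this cpoly_has_derivative[OF p(1)]]
      show ?thesis
        by (simp only: has_vector_derivative_def sum_e q)
    qed
    then obtain c where "p (x + t *\<^sub>R ?e) = c" for t
      using has_vector_derivative_zero_constant[of UNIV "\<lambda>t. p (x + t *\<^sub>R ?e)"] by auto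
    from this[of 0] this[of t] show ?thesis by simp
  qed
  have p0: "p 0 = 0"
    using p(2)[of 0 x] by simp
  obtain j where j: "j \<noteq> k"
    using exists_distinct_index[of k] d by force
  define c where "c = p (axis j 1)"
  define \<rho> where "\<rho> x = norm (x - (x $ k) *\<^sub>R ?e)" for x
  \<comment> \<open>The component along the axis is dropped by \<open>shift\<close>, the length of
    the rest is split off by homogeneity, and a rotation about the pole carries the remaining unit
    vector to \<open>axis j 1\<close>.\<close>
  have p_eq: "p x = of_real (\<rho> x ^ Suc n) * c" for x
  proof (cases "\<rho> x = 0")
    case True
    then have "x = (x $ k) *\<^sub>R ?e" by (simp add: \<rho>_def)
    then have "p x = 0" using shift[of 0 "x $ k"] p0 by simp
    then show ?thesis by (simp add: True)
  next
    case False
    define x' where "x' = x - (x $ k) *\<^sub>R ?e"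
    define v where "v = x' /\<^sub>R \<rho> x"
    have v: "norm v = 1" "x' = \<rho> x *\<^sub>R v"
      using False by (simp_all add: v_def x'_def \<rho>_def)
    have "?e \<bullet> v = 0"
      by (simp add: v_def x'_def inner_diff_right inner_axis_axis inner_axis')
    then obtain h where h: "h \<in> SO" "h *v ?e = ?e" "h *v v = axis j 1"
      using SO_two_point_transitive[OF d, of ?e ?e v "axis j 1"] v j
      by (auto simp: norm_axis_1 inner_axis_axis)
    have "p x = p x'" using shift[of x' "x $ k"] by (simp add: x'_def)
    also have "\<dots> = of_real (\<rho> x ^ Suc n) * p v" by (simp only: v(2) p(2))
    also have "p v = c" using Suc.prems(2)[OF h(1,2), of v] by (simp add: h(3) c_def)
    finally show ?thesis .
  qed
  have "c = 0"
  proof (rule ccontr)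
    assume "c \<noteq> 0"
    have \<rho>c: "continuous_on (sphere 0 1) (\<lambda>x. \<rho> x ^ Suc n)"
      unfolding \<rho>_def by (intro continuous_intros)
    \<comment> \<open>The degree \<open>Suc n\<close> differs from 0, so \<open>p\<close> is
      orthogonal to constants. Apart from the constant \<open>c\<close> the integrand is
      nonnegative; a vanishing mean would place the whole measure on the axis.\<close>
    have "(LINT x|\<omega>. p x * 1) = 0"
      using d by (intro integral_harmonic_mult[OF Suc.prems(1) harmonic_const]) auto
    then have "(LINT x|\<omega>. of_real (\<rho> x ^ Suc n) * c) = 0"
      by (simp only: mult_1_right p_eq[symmetric])
    then have "complex_of_real (LINT x|\<omega>. \<rho> x ^ Suc n) = 0"
      using \<open>c \<noteq> 0\<close> by (simp only: integral_mult_left_zero integral_complex_of_real mult_eq_0_iff) simp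
    then have "(LINT x|\<omega>. \<rho> x ^ Suc n) = 0" by (simp only: of_real_eq_0_iff)
    then have "AE x in \<omega>. \<rho> x ^ Suc n = 0"
      using integral_nonneg_eq_0_iff_AE[OF integrable_continuous_on[OF \<rho>c]] by (simp add: \<rho>_def)
    then have "AE x in \<omega>. (x $ k)\<^sup>2 = 1"
      using AE_space
    proof eventually_elim
      case (elim x)
      then have "\<rho> x = 0" and "norm x = 1" by (simp_all only: power_eq_0_iff) simp
      then have "x = (x $ k) *\<^sub>R ?e" by (simp add: \<rho>_def)
      then have "\<bar>x $ k\<bar> = 1"
        using \<open>norm x = 1\<close> by (metis norm_axis_1 norm_scaleR mult.right_neutral)
      then show ?case by (simp only: abs_square_eq_1)
    qed
    then show False using not_AE_coord_sq_eq_one[OF d] by blast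
  qed
  then show ?case by (simp add: p_eq)
qed

end

section \<open>The inner product of square-integrable functions\<close>

lemma L2_integrable_mult:
  assumes "f \<in> L2 M" "g \<in> L2 M"
  shows "integrable M (\<lambda>x. f x * cnj (g x))"
proof (rule Bochner_Integration.integrable_bound)
  show "integrable M (\<lambda>x. (cmod (f x))\<^sup>2 + (cmod (g x))\<^sup>2)"
    using assms by (auto simp: L2_def)
  show "(\<lambda>x. f x * cnj (g x)) \<in> borel_measurable M"
    using assms by (auto simp: L2_def intro!: borel_measurable_times
        borel_measurable_continuous_on[of cnj] continuous_intros)
  have "a * b \<le> a\<^sup>2 + b\<^sup>2" for a b :: real
    using sum_squares_bound[of a b] zero_le_power2[of a] zero_le_power2[of b] by linarith
  then show "AE x in M. norm (f x * cnj (g x)) \<le> norm ((cmod (f x))\<^sup>2 + (cmod (g x))\<^sup>2)"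
    by (simp add: norm_mult)
qed

lemma L2_add:
  assumes "f \<in> L2 M" "g \<in> L2 M" shows "(\<lambda>x. f x + g x) \<in> L2 M"
proof -
  have "integrable M (\<lambda>x. (cmod (f x + g x))\<^sup>2)"
  proof (rule Bochner_Integration.integrable_bound)
    show "integrable M (\<lambda>x. 2 * (cmod (f x))\<^sup>2 + 2 * (cmod (g x))\<^sup>2)"
      using assms by (auto simp: L2_def)
    show "(\<lambda>x. (cmod (f x + g x))\<^sup>2) \<in> borel_measurable M"
      using assms by (auto simp: L2_def)
    have "(cmod (a + b))\<^sup>2 \<le> 2 * (cmod a)\<^sup>2 + 2 * (cmod b)\<^sup>2" for a b
    proof -
      have "(cmod (a + b))\<^sup>2 \<le> (cmod a + cmod b)\<^sup>2"
        by (intro power_mono norm_triangle_ineq) simp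
      also have "\<dots> \<le> 2 * (cmod a)\<^sup>2 + 2 * (cmod b)\<^sup>2"
        using sum_squares_bound[of "cmod a" "cmod b"] by (simp add: power2_sum)
      finally show ?thesis .
    qed
    then show "AE x in M. norm ((cmod (f x + g x))\<^sup>2) \<le> norm (2 * (cmod (f x))\<^sup>2 + 2 * (cmod (g x))\<^sup>2)"
      by simp
  qed
  then show ?thesis using assms by (auto simp: L2_def intro: borel_measurable_add)
qed

lemma L2_zero: "(\<lambda>x. 0) \<in> L2 M"
  by (simp add: L2_def)

lemma L2_cmult: "f \<in> L2 M \<Longrightarrow> (\<lambda>x. c * f x) \<in> L2 M"
  by (auto simp: L2_def norm_mult power_mult_distrib)

lemma L2_diff: "f \<in> L2 M \<Longrightarrow> g \<in> L2 M \<Longrightarrow> (\<lambda>x. f x - g x) \<in> L2 M"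
  using L2_add[of f M "\<lambda>x. (-1) * g x"] L2_cmult[of g M "-1"] by simp

lemma L2_sum: "(\<And>i. i \<in> S \<Longrightarrow> f i \<in> L2 M) \<Longrightarrow> (\<lambda>x. \<Sum>i\<in>S. f i x) \<in> L2 M"
  by (induction S rule: infinite_finite_induct) (simp_all add: L2_add L2_zero)

lemma L2_inner_commute: "L2_inner M g f = cnj (L2_inner M f g)"
proof -
  have "L2_inner M g f = (LINT x|M. cnj (f x * cnj (g x)))"
    by (simp add: L2_inner_def mult.commute)
  then show ?thesis by (simp only: Bochner_Integration.integral_cnj L2_inner_def)
qed

lemma L2_inner_diff_left:
  "f \<in> L2 M \<Longrightarrow> g \<in> L2 M \<Longrightarrow> h \<in> L2 M \<Longrightarrow>
    L2_inner M (\<lambda>x. f x - g x) h = L2_inner M f h - L2_inner M g h"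
  by (simp add: L2_inner_def left_diff_distrib L2_integrable_mult)

lemma L2_inner_cmult_left: "L2_inner M (\<lambda>x. c * f x) h = c * L2_inner M f h"
  by (simp add: L2_inner_def mult.assoc)

lemma L2_inner_sum_left:
  assumes "\<And>i. i \<in> S \<Longrightarrow> f i \<in> L2 M" "h \<in> L2 M"
  shows "L2_inner M (\<lambda>x. \<Sum>i\<in>S. f i x) h = (\<Sum>i\<in>S. L2_inner M (f i) h)"
  using assms by (simp add: L2_inner_def sum_distrib_right L2_integrable_mult)

lemma L2_inner_cmult_right: "L2_inner M f (\<lambda>x. c * h x) = cnj c * L2_inner M f h"
  by (simp add: L2_inner_def mult.left_commute)

lemma L2_inner_diff_right:
  "f \<in> L2 M \<Longrightarrow> g \<in> L2 M \<Longrightarrow> h \<in> L2 M \<Longrightarrow>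
    L2_inner M h (\<lambda>x. f x - g x) = L2_inner M h f - L2_inner M h g"
  by (simp add: L2_inner_def right_diff_distrib L2_integrable_mult)

lemma L2_inner_sum_right:
  assumes "\<And>i. i \<in> S \<Longrightarrow> f i \<in> L2 M" "h \<in> L2 M"
  shows "L2_inner M h (\<lambda>x. \<Sum>i\<in>S. f i x) = (\<Sum>i\<in>S. L2_inner M h (f i))"
  using assms by (simp add: L2_inner_def sum_distrib_left L2_integrable_mult)

lemma L2_norm_nonneg: "0 \<le> L2_norm M f"
  by (simp add: L2_norm_def)

lemma L2_norm_sq: "complex_of_real ((L2_norm M f)\<^sup>2) = L2_inner M f f"
proof -
  have "L2_inner M f f = (LINT x|M. complex_of_real ((cmod (f x))\<^sup>2))"
    unfolding L2_inner_def by (intro Bochner_Integration.integral_cong refl) (simp only: complex_norm_square)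
  also have "\<dots> = complex_of_real (LINT x|M. (cmod (f x))\<^sup>2)"
    by (rule integral_complex_of_real)
  finally show ?thesis by (simp add: L2_norm_def)
qed

definition orthonormal_on :: "'a measure \<Rightarrow> 'i set \<Rightarrow> ('i \<Rightarrow> 'a \<Rightarrow> complex) \<Rightarrow> bool" where
  "orthonormal_on M S e \<longleftrightarrow> (\<forall>i\<in>S. e i \<in> L2 M) \<and>
     (\<forall>i\<in>S. \<forall>j\<in>S. L2_inner M (e i) (e j) = (if i = j then 1 else 0))"

text \<open>Completing the square separates the part of \<open>f\<close> outside the span from the
  deviation of \<open>b\<close> from the Fourier coefficients. Bessel's inequality and the remainder
  of a multiplier operator are both instances.\<close>

lemma L2_norm_diff_orthonormal:
  assumes "orthonormal_on M S e" "finite S" and f: "f \<in> L2 M"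
  shows "(L2_norm M (\<lambda>x. f x - (\<Sum>i\<in>S. b i * e i x)))\<^sup>2
    = (L2_norm M f)\<^sup>2 - (\<Sum>i\<in>S. (cmod (L2_inner M f (e i)))\<^sup>2) + (\<Sum>i\<in>S. (cmod (L2_inner M f (e i) - b i))\<^sup>2)"
proof -
  have e: "e i \<in> L2 M" "(\<lambda>x. b i * e i x) \<in> L2 M" if "i \<in> S" for i
    using assms(1) that by (auto simp: orthonormal_on_def intro: L2_cmult)
  define u where "u x = (\<Sum>i\<in>S. b i * e i x)" for x
  have u: "u \<in> L2 M" unfolding u_def by (intro L2_sum e)
  define a where "a i = L2_inner M f (e i)" for i
  have fu: "L2_inner M f u = (\<Sum>i\<in>S. a i * cnj (b i))"
    unfolding u_def by (simp add: L2_inner_sum_right e f L2_inner_cmult_right a_def mult.commute)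
  have uf: "L2_inner M u f = (\<Sum>i\<in>S. cnj (a i) * b i)"
    by (subst L2_inner_commute) (simp add: fu)
  have ue: "L2_inner M u (e i) = b i" if "i \<in> S" for i
  proof -
    have "L2_inner M u (e i) = (\<Sum>j\<in>S. b j * (if j = i then 1 else 0))"
      using that assms(1) unfolding u_def
      by (simp add: L2_inner_sum_left e L2_inner_cmult_left orthonormal_on_def)
    then show ?thesis using that assms(2) by (simp add: if_distrib cong: if_cong)
  qed
  have uu: "L2_inner M u u = (\<Sum>i\<in>S. b i * cnj (b i))"
  proof -
    have "L2_inner M u u = (\<Sum>i\<in>S. cnj (b i) * L2_inner M u (e i))"
    proof -
      have "L2_inner M u u = L2_inner M u (\<lambda>x. \<Sum>i\<in>S. b i * e i x)"
        by (rule arg_cong[of _ _ "L2_inner M u"]) (rule ext, rule u_def)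
      then show ?thesis by (simp add: L2_inner_sum_right e u L2_inner_cmult_right)
    qed
    then show ?thesis by (simp add: ue mult.commute)
  qed
  have "complex_of_real ((L2_norm M (\<lambda>x. f x - u x))\<^sup>2)
    = L2_inner M f f - L2_inner M f u - L2_inner M u f + L2_inner M u u"
    by (simp only: L2_norm_sq) (simp add: L2_inner_diff_left L2_inner_diff_right f u L2_diff)
  also have "\<dots> = L2_inner M f f - (\<Sum>i\<in>S. a i * cnj (a i)) + (\<Sum>i\<in>S. (a i - b i) * cnj (a i - b i))"
    unfolding fu uf uu by (simp add: algebra_simps sum.distrib sum_subtractf)
  also have "\<dots> = complex_of_real ((L2_norm M f)\<^sup>2 - (\<Sum>i\<in>S. (cmod (a i))\<^sup>2) + (\<Sum>i\<in>S. (cmod (a i - b i))\<^sup>2))"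
    by (simp only: complex_norm_square[symmetric] L2_norm_sq[symmetric] of_real_sum of_real_add of_real_diff)
  finally show ?thesis
    by (simp only: of_real_eq_iff u_def a_def)
qed

section \<open>Closure properties and orthogonality of the spaces of spherical harmonics\<close>

lemma spherical_harmonics_outside: "f \<in> spherical_harmonics n \<Longrightarrow> norm x \<noteq> 1 \<Longrightarrow> f x = 0"
  by (auto simp: spherical_harmonics_def sphere_restrict_def)

lemma spherical_harmonics_SO:
  assumes "f \<in> spherical_harmonics n" "h \<in> SO"
  shows "(\<lambda>x. f (h *v x)) \<in> spherical_harmonics n"
proof -
  obtain p where p: "harmonic_homogeneous_poly n p" "f = sphere_restrict p"
    using assms(1) by (auto simp: spherical_harmonics_def)
  then have "(\<lambda>x. f (h *v x)) = sphere_restrict (\<lambda>x. p (h *v x))"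
    using assms(2) by (auto simp: sphere_restrict_def)
  then show ?thesis
    using harmonic_SO[OF p(1) assms(2)] by (auto simp: spherical_harmonics_def)
qed

lemma spherical_harmonics_cnj:
  assumes "f \<in> spherical_harmonics n"
  shows "(\<lambda>x. cnj (f x)) \<in> spherical_harmonics n"
proof -
  obtain p where p: "harmonic_homogeneous_poly n p" "f = sphere_restrict p"
    using assms(1) by (auto simp: spherical_harmonics_def)
  then have "(\<lambda>x. cnj (f x)) = sphere_restrict (\<lambda>x. cnj (p x))"
    by (auto simp: sphere_restrict_def)
  then show ?thesis
    using harmonic_cnj[OF p(1)] by (auto simp: spherical_harmonics_def)
qed

lemma spherical_harmonics_add:
  assumes "f \<in> spherical_harmonics n" "g \<in> spherical_harmonics n"
  shows "(\<lambda>x. f x + g x) \<in> spherical_harmonics n"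
proof -
  obtain p q where p: "harmonic_homogeneous_poly n p" "f = sphere_restrict p"
    "harmonic_homogeneous_poly n q" "g = sphere_restrict q"
    using assms by (auto simp: spherical_harmonics_def)
  then have "(\<lambda>x. f x + g x) = sphere_restrict (\<lambda>x. p x + q x)"
    by (auto simp: sphere_restrict_def)
  then show ?thesis
    using harmonic_add[OF p(1,3)] by (auto simp: spherical_harmonics_def)
qed

lemma spherical_harmonics_cmult:
  assumes "f \<in> spherical_harmonics n"
  shows "(\<lambda>x. c * f x) \<in> spherical_harmonics n"
proof -
  obtain p where p: "harmonic_homogeneous_poly n p" "f = sphere_restrict p"
    using assms(1) by (auto simp: spherical_harmonics_def)
  then have "(\<lambda>x. c * f x) = sphere_restrict (\<lambda>x. c * p x)"
    by (auto simp: sphere_restrict_def)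
  then show ?thesis
    using harmonic_cmult[OF p(1)] by (auto simp: spherical_harmonics_def)
qed

lemma spherical_harmonics_zero: "(\<lambda>x. 0) \<in> spherical_harmonics n"
proof -
  have "harmonic_homogeneous_poly n (\<lambda>x. 0)"
    by (intro harmonicI) (simp_all add: cpoly_const laplacian_def)
  moreover have "(\<lambda>x. 0) = sphere_restrict (\<lambda>x. 0)" by (auto simp: sphere_restrict_def)
  ultimately show ?thesis by (auto simp: spherical_harmonics_def)
qed

lemma spherical_harmonics_sum:
  "(\<And>i. i \<in> S \<Longrightarrow> f i \<in> spherical_harmonics n) \<Longrightarrow> (\<lambda>x. \<Sum>i\<in>S. f i x) \<in> spherical_harmonics n"
  by (induction S rule: infinite_finite_induct)
    (simp_all add: spherical_harmonics_zero spherical_harmonics_add)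

text \<open>Makes division by the dimension legitimate in every degree: the power of a complex
  linear form takes the value 1 at \<open>axis i 1\<close>.\<close>

lemma spherical_harmonics_nonzero:
  assumes "CARD('n) \<ge> 2"
  obtains f :: "real ^ 'n \<Rightarrow> complex" where "f \<in> spherical_harmonics n" "f \<noteq> (\<lambda>x. 0)"
proof -
  fix i :: 'n
  obtain j where j: "i \<noteq> j"
    using exists_distinct_index[of i] assms by metis
  let ?p = "\<lambda>x. (complex_of_real (x $ i) + \<i> * complex_of_real (x $ j)) ^ n"
  have "sphere_restrict ?p (axis i 1) = 1"
    using j by (simp add: sphere_restrict_def norm_axis_1) (simp add: axis_def)
  then have "sphere_restrict ?p \<noteq> (\<lambda>x. 0)"
    by (metis zero_neq_one)
  moreover have "sphere_restrict ?p \<in> spherical_harmonics n"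
    using harmonic_power[OF j, of n] by (auto simp: spherical_harmonics_def)
  ultimately show ?thesis
    using that by blast
qed

lemma sum_fun_apply: "(\<Sum>i\<in>S. f i) x = (\<Sum>i\<in>S. f i x)" for f :: "_ \<Rightarrow> _ \<Rightarrow> 'b::comm_monoid_add"
  by (induction S rule: infinite_finite_induct) auto

context sphere_measure
begin

lemma sphere_restrict_L2: assumes "cpoly p" shows "sphere_restrict p \<in> L2 \<omega>"
proof -
  have "continuous_on (sphere 0 1) p" using assms by (rule cpoly_continuous_on)
  then have c: "continuous_on (sphere 0 1) (sphere_restrict p)"
    by (rule continuous_on_eq) (simp add: sphere_restrict_def)
  then show ?thesis
    by (auto simp: L2_def intro!: measurable_continuous_on integrable_continuous_on continuous_intros)
qed

lemma spherical_harmonics_L2: "f \<in> spherical_harmonics n \<Longrightarrow> f \<in> L2 \<omega>"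
  using harmonicD(1) by (auto simp: spherical_harmonics_def intro: sphere_restrict_L2)

lemma spherical_harmonics_orthogonal:
  assumes "f \<in> spherical_harmonics m" "g \<in> spherical_harmonics n" "m \<noteq> n" "CARD('n) \<ge> 2"
  shows "L2_inner \<omega> f g = 0"
proof -
  obtain p q where p: "harmonic_homogeneous_poly m p" "f = sphere_restrict p"
    "harmonic_homogeneous_poly n q" "g = sphere_restrict q"
    using assms by (auto simp: spherical_harmonics_def)
  have "L2_inner \<omega> f g = (LINT x|\<omega>. p x * cnj (q x))"
    unfolding L2_inner_def by (intro Bochner_Integration.integral_cong refl) (simp add: p sphere_restrict_def)
  also have "\<dots> = 0"
    by (rule integral_harmonic_mult[OF p(1) harmonic_cnj[OF p(3)] assms(3,4)])
  finally show ?thesis .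
qed

lemma L2_inner_SO:
  assumes "h \<in> SO" "f \<in> L2 \<omega>" "g \<in> L2 \<omega>"
  shows "L2_inner \<omega> (\<lambda>x. f (h *v x)) (\<lambda>x. g (h *v x)) = L2_inner \<omega> f g"
  unfolding L2_inner_def
  by (rule integral_SO[OF assms(1), of "\<lambda>x. f x * cnj (g x)"])
    (rule borel_measurable_integrable[OF L2_integrable_mult[OF assms(2,3)]])

text \<open>Carries \<open>zonal_harmonic_eq_zero\<close> over from polynomials to their
  restrictions: invariance on the unit sphere extends to all of space by homogeneity.\<close>

lemma zonal_spherical_harmonic_eq_zero:
  fixes k :: 'n
  assumes d: "CARD('n) \<ge> 3" and f: "f \<in> spherical_harmonics n"
    and inv: "\<And>h x. h \<in> SO \<Longrightarrow> h *v axis k 1 = axis k 1 \<Longrightarrow> f (h *v x) = f x"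
    and "f (axis k 1) = 0"
  shows "f x = 0"
proof -
  obtain p where p: "harmonic_homogeneous_poly n p" "f = sphere_restrict p"
    using f by (auto simp: spherical_harmonics_def)
  have "p x = 0" for x
  proof (rule zonal_harmonic_eq_zero[OF d p(1)])
    show "p (axis k 1) = 0" using assms(4) p(2) by (simp add: sphere_restrict_def norm_axis_1)
    show "p (h *v x) = p x" if h: "h \<in> SO" "h *v axis k 1 = axis k 1" for h x
    proof (cases "x = 0")
      case False
      define v where "v = x /\<^sub>R norm x"
      have v: "norm v = 1" "x = norm x *\<^sub>R v" using False by (simp_all add: v_def)
      have "p (h *v v) = p v"
        using inv[OF h, of v] v(1) h(1) by (simp add: p(2) sphere_restrict_def)
      moreover have "h *v x = norm x *\<^sub>R (h *v v)"
        using v(2) linear_scale[OF matrix_vector_mul_linear] by metis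
      ultimately show ?thesis
        using harmonicD(2)[OF p(1), of "norm x" "h *v v"] harmonicD(2)[OF p(1), of "norm x" v] v(2)
        by metis
    qed simp
  qed
  then show ?thesis by (simp add: p(2) sphere_restrict_def)
qed

end

section \<open>Rotation-invariant kernels\<close>

lemma cfun_span_cmult: "u \<in> cfun.span B \<Longrightarrow> (\<lambda>g. c * u g) \<in> cfun.span B"
  using cfun.span_scale[of u B c] by (simp add: cfun_scale_def)

lemma cfun_span_sum:
  assumes "\<And>i. i \<in> S \<Longrightarrow> u i \<in> cfun.span B"
  shows "(\<lambda>g. \<Sum>i\<in>S. u i g) \<in> cfun.span B"
proof -
  have "(\<lambda>g. \<Sum>i\<in>S. u i g) = (\<Sum>i\<in>S. u i)"
    by (simp add: fun_eq_iff sum_fun_apply)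
  then show ?thesis using cfun.span_sum[OF assms] by simp
qed

text \<open>Components above \<open>N\<close> are replaced by 0, which belongs to every degree;
  later sums then need no side condition on the degree.\<close>

lemma sphere_polysE:
  assumes "\<Phi> \<in> sphere_polys N"
  obtains h where "\<And>n. h n \<in> spherical_harmonics n" "\<Phi> = (\<lambda>x. \<Sum>n\<le>N. h n x)"
proof -
  obtain h where h: "\<forall>n\<le>N. h n \<in> spherical_harmonics n" "\<Phi> = (\<Sum>n\<le>N. h n)"
    using assms by (auto simp: sphere_polys_def)
  define h' where "h' n = (if n \<le> N then h n else (\<lambda>x. 0))" for n
  have "\<Phi> = (\<lambda>x. \<Sum>n\<le>N. h' n x)"
    by (auto simp: h(2) h'_def fun_eq_iff sum_fun_apply intro!: sum.cong)
  moreover have "h' n \<in> spherical_harmonics n" for n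
    using h(1) by (simp add: h'_def spherical_harmonics_zero)
  ultimately show ?thesis using that by blast
qed

lemma spherical_harmonics_sphere_polys:
  assumes "f \<in> spherical_harmonics n" "n \<le> N"
  shows "f \<in> sphere_polys N"
proof -
  define h where "h m = (if m = n then f else (\<lambda>x. 0))" for m
  have "f = (\<Sum>m\<le>N. h m)"
    using assms(2) by (auto simp: h_def fun_eq_iff sum_fun_apply if_distribR cong: if_cong)
  moreover have "\<forall>m\<le>N. h m \<in> spherical_harmonics m"
    using assms(1) by (simp add: h_def spherical_harmonics_zero)
  ultimately show ?thesis unfolding sphere_polys_def by blast
qed

lemma sphere_polys_cnj:
  assumes "\<Phi> \<in> sphere_polys N" shows "(\<lambda>x. cnj (\<Phi> x)) \<in> sphere_polys N"
proof -
  obtain h where h: "\<And>n. h n \<in> spherical_harmonics n" "\<Phi> = (\<lambda>x. \<Sum>n\<le>N. h n x)"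
    using sphere_polysE[OF assms] by blast
  have "(\<lambda>x. cnj (\<Phi> x)) = (\<Sum>n\<le>N. (\<lambda>x. cnj (h n x)))"
    by (simp add: h(2) fun_eq_iff sum_fun_apply)
  then show ?thesis
    using spherical_harmonics_cnj[OF h(1)] unfolding sphere_polys_def by blast
qed

lemma sphere_polys_restrict:
  assumes "\<Phi> \<in> sphere_polys N"
  obtains P where "cpoly P" "\<Phi> = sphere_restrict P"
proof -
  obtain h where h: "\<And>n. h n \<in> spherical_harmonics n" "\<Phi> = (\<lambda>x. \<Sum>n\<le>N. h n x)"
    using sphere_polysE[OF assms] by blast
  have "\<forall>n. \<exists>p. cpoly p \<and> h n = sphere_restrict p"
    using h(1) harmonicD(1) by (fastforce simp: spherical_harmonics_def)
  then obtain p where p: "\<And>n. cpoly (p n)" "\<And>n. h n = sphere_restrict (p n)"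
    by metis
  have "\<Phi> = sphere_restrict (\<lambda>x. \<Sum>n\<le>N. p n x)"
    by (auto simp: h(2) p(2) sphere_restrict_def)
  then show ?thesis using that[OF cpoly_sum[of "{..N}" p, OF p(1)]] by blast
qed

section \<open>Fourier expansion and the zonal kernel\<close>

locale harmonic_basis = sphere_measure \<omega> for \<omega> :: "(real ^ 'n) measure" +
  fixes \<I> :: "nat \<Rightarrow> 'k set" and Y :: "nat \<Rightarrow> 'k \<Rightarrow> real ^ 'n \<Rightarrow> complex"
  assumes dimension: "CARD('n) \<ge> 3"
    and finite_index: "\<And>n. finite (\<I> n)"
    and basis: "\<And>n. orthonormal_basis_of \<omega> (spherical_harmonics n) (\<I> n) (Y n)"
begin

lemma Y_harmonic: "k \<in> \<I> n \<Longrightarrow> Y n k \<in> spherical_harmonics n"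
  using basis[of n] by (simp add: orthonormal_basis_of_def)

lemma Y_L2: "k \<in> \<I> n \<Longrightarrow> Y n k \<in> L2 \<omega>"
  by (rule spherical_harmonics_L2[OF Y_harmonic])

lemma Y_inner: "k \<in> \<I> n \<Longrightarrow> m \<in> \<I> n \<Longrightarrow> L2_inner \<omega> (Y n k) (Y n m) = (if k = m then 1 else 0)"
  using basis[of n] by (simp add: orthonormal_basis_of_def)

lemma orthonormal_Y: "orthonormal_on \<omega> (SIGMA n:S. \<I> n) (\<lambda>(n, k). Y n k)"
  unfolding orthonormal_on_def
proof (intro conjI ballI)
  fix i j assume i: "i \<in> (SIGMA n:S. \<I> n)" and j: "j \<in> (SIGMA n:S. \<I> n)"
  then obtain n k m l where nk: "i = (n, k)" "k \<in> \<I> n" "j = (m, l)" "l \<in> \<I> m" by auto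
  show "L2_inner \<omega> (case i of (n, k) \<Rightarrow> Y n k) (case j of (n, k) \<Rightarrow> Y n k) = (if i = j then 1 else 0)"
  proof (cases "n = m")
    case True
    then show ?thesis using nk Y_inner[of k n l] by simp
  next
    case False
    then show ?thesis
      using nk spherical_harmonics_orthogonal[OF Y_harmonic[OF nk(2)] Y_harmonic[OF nk(4)]] dimension by simp
  qed
qed (auto intro: Y_L2)

lemma Y_expansion:
  assumes "f \<in> spherical_harmonics n"
  shows "f x = (\<Sum>k\<in>\<I> n. L2_inner \<omega> f (Y n k) * Y n k x)"
proof -
  have "f \<in> cfun.span (Y n ` \<I> n)"
    using basis[of n] assms by (simp add: orthonormal_basis_of_def)
  then obtain u where u: "f = (\<Sum>v\<in>Y n ` \<I> n. cfun_scale (u v) v)"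
    using cfun.span_finite[of "Y n ` \<I> n"] finite_index[of n] by auto
  \<comment> \<open>Two indices with the same function would have inner product both 0 and 1.
    Injectivity allows the span of the image to be summed over the indices.\<close>
  have inj: "inj_on (Y n) (\<I> n)"
    by (rule inj_onI) (metis Y_inner zero_neq_one)
  define a where "a k = u (Y n k)" for k
  have f: "f = (\<lambda>x. \<Sum>k\<in>\<I> n. a k * Y n k x)"
    by (simp add: u sum.reindex[OF inj] fun_eq_iff sum_fun_apply cfun_scale_def a_def)
  have "L2_inner \<omega> f (Y n m) = a m" if "m \<in> \<I> n" for m
  proof -
    have "L2_inner \<omega> f (Y n m) = (\<Sum>k\<in>\<I> n. a k * (if k = m then 1 else 0))"
      unfolding f using that by (simp add: L2_inner_sum_left L2_cmult Y_L2 L2_inner_cmult_left Y_inner)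
    then show ?thesis using that finite_index by (simp add: if_distrib cong: if_cong)
  qed
  then show ?thesis by (simp add: f)
qed

lemma parseval:
  assumes "f \<in> spherical_harmonics n" "g \<in> L2 \<omega>"
  shows "L2_inner \<omega> f g = (\<Sum>k\<in>\<I> n. L2_inner \<omega> f (Y n k) * cnj (L2_inner \<omega> g (Y n k)))"
proof -
  have "f = (\<lambda>x. \<Sum>k\<in>\<I> n. L2_inner \<omega> f (Y n k) * Y n k x)"
    using Y_expansion[OF assms(1)] by blast
  then have "L2_inner \<omega> f g = L2_inner \<omega> (\<lambda>x. \<Sum>k\<in>\<I> n. L2_inner \<omega> f (Y n k) * Y n k x) g"
    by simp
  then show ?thesis
    using assms(2) by (simp add: L2_inner_sum_left L2_cmult Y_L2 L2_inner_cmult_left L2_inner_commute[of \<omega> "Y n _" g])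
qed

text \<open>The reproducing kernel of the harmonics of degree \<open>n\<close>. Classically it is,
  on the sphere, a multiple of a Gegenbauer polynomial in the inner product of \<open>x\<close> and
  \<open>y\<close>.\<close>

definition zonal_kernel :: "nat \<Rightarrow> real ^ 'n \<Rightarrow> real ^ 'n \<Rightarrow> complex" where
  "zonal_kernel n x y = (\<Sum>k\<in>\<I> n. Y n k x * cnj (Y n k y))"

lemma zonal_kernel_harmonic: "(\<lambda>x. zonal_kernel n x y) \<in> spherical_harmonics n"
  unfolding zonal_kernel_def
  by (intro spherical_harmonics_sum, subst mult.commute, intro spherical_harmonics_cmult Y_harmonic)

text \<open>A rotation acts on the orthonormal basis by a unitary matrix \<open>a\<close>, and the
  kernel is the sesquilinear form of the identity matrix.\<close>

lemma zonal_kernel_SO: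
  assumes h: "h \<in> SO"
  shows "zonal_kernel n (h *v x) (h *v y) = zonal_kernel n x y"
proof -
  let ?h = "\<lambda>f x. f (h *v x)" and ?t = "\<lambda>f x. f (transpose h *v x)"
  define a where "a k m = L2_inner \<omega> (?h (Y n k)) (Y n m)" for k m
  have exp: "Y n k (h *v x) = (\<Sum>m\<in>\<I> n. a k m * Y n m x)" if "k \<in> \<I> n" for k x
    unfolding a_def by (rule Y_expansion[OF spherical_harmonics_SO[OF Y_harmonic[OF that] h]])
  have th: "?t (Y n m) \<in> spherical_harmonics n" if "m \<in> \<I> n" for m
    using that h by (intro spherical_harmonics_SO Y_harmonic SO_transpose)
  have a: "a k m = cnj (L2_inner \<omega> (?t (Y n m)) (Y n k))" if "k \<in> \<I> n" "m \<in> \<I> n" for k m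
  proof -
    have "a k m = L2_inner \<omega> (Y n k) (?t (Y n m))"
      using L2_inner_SO[OF h Y_L2[OF that(1)] spherical_harmonics_L2[OF th[OF that(2)]]] h
      by (simp add: a_def del: transpose_matrix_vector vector_transpose_matrix)
    then show ?thesis by (simp only: L2_inner_commute[of \<omega> "Y n k"])
  qed
  \<comment> \<open>Orthogonality of the columns of \<open>a\<close>: they are, up to conjugation,
    the coefficients of basis functions rotated by the inverse, so Parseval and invariance of the
    inner product apply.\<close>
  have orth: "(\<Sum>k\<in>\<I> n. a k m * cnj (a k l)) = (if m = l then 1 else 0)" if "m \<in> \<I> n" "l \<in> \<I> n" for m l
  proof -
    have "(\<Sum>k\<in>\<I> n. a k m * cnj (a k l))
      = (\<Sum>k\<in>\<I> n. L2_inner \<omega> (?t (Y n l)) (Y n k) * cnj (L2_inner \<omega> (?t (Y n m)) (Y n k)))"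
      using that by (intro sum.cong refl) (simp only: a complex_cnj_cnj mult.commute)
    also have "\<dots> = L2_inner \<omega> (?t (Y n l)) (?t (Y n m))"
      using that by (intro parseval[symmetric] th spherical_harmonics_L2[OF th])
    also have "\<dots> = L2_inner \<omega> (Y n l) (Y n m)"
      using that h by (intro L2_inner_SO SO_transpose Y_L2)
    finally show ?thesis using that by (auto simp: Y_inner)
  qed
  have "zonal_kernel n (h *v x) (h *v y)
    = (\<Sum>k\<in>\<I> n. \<Sum>m\<in>\<I> n. \<Sum>l\<in>\<I> n. (a k m * cnj (a k l)) * (Y n m x * cnj (Y n l y)))"
    unfolding zonal_kernel_def
    by (intro sum.cong refl) (simp add: exp sum_product mult.assoc mult.left_commute)
  also have "\<dots> = (\<Sum>m\<in>\<I> n. \<Sum>l\<in>\<I> n. \<Sum>k\<in>\<I> n. (a k m * cnj (a k l)) * (Y n m x * cnj (Y n l y)))"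
    by (subst sum.swap, rule sum.cong[OF refl], rule sum.swap)
  also have "\<dots> = (\<Sum>m\<in>\<I> n. \<Sum>l\<in>\<I> n. (if m = l then 1 else 0) * (Y n m x * cnj (Y n l y)))"
    by (intro sum.cong refl) (simp only: sum_distrib_right[symmetric] orth)
  also have "\<dots> = zonal_kernel n x y"
    using finite_index[of n]
    by (simp add: zonal_kernel_def if_distrib if_distribR cong: if_cong)
  finally show ?thesis .
qed

lemma sphere_transitive:
  fixes x y :: "real ^ 'n"
  assumes "norm x = 1" "norm y = 1" obtains h where "h \<in> SO" "h *v x = y"
  using SO_transitive[OF dimension, of x y] assms by auto

text \<open>A rotation can swap two points of the sphere, so invariant kernels are symmetric. Hence a
  kernel of degree \<open>n\<close> in one and \<open>m\<close> in the other variable has both degrees in each variable.\<close>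

lemma invariant_kernel_eq_zero:
  fixes K :: "real ^ 'n \<Rightarrow> real ^ 'n \<Rightarrow> complex"
  assumes inv: "\<And>h x y. h \<in> SO \<Longrightarrow> K (h *v x) (h *v y) = K x y"
    and K1: "\<And>y. (\<lambda>x. K x y) \<in> spherical_harmonics n"
    and K2: "\<And>x. (\<lambda>y. K x y) \<in> spherical_harmonics m"
    and "n \<noteq> m" "norm y = 1"
  shows "K x y = 0"
proof -
  have swap: "K x y = K y x" for x
  proof (cases "norm x = 1")
    case True
    then obtain h where "h \<in> SO" "h *v x = y" "h *v y = x"
      using SO_two_point_transitive[OF dimension, of x y y x] \<open>norm y = 1\<close> by (auto simp: inner_commute)
    then show ?thesis using inv[of h x y] by simp
  next
    case False
    then show ?thesis
      using spherical_harmonics_outside[OF K1[of y]] spherical_harmonics_outside[OF K2[of y]] by simp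
  qed
  have n: "(\<lambda>x. K x y) \<in> spherical_harmonics n" by (rule K1)
  have m: "(\<lambda>x. K x y) \<in> spherical_harmonics m" using K2[of y] by (simp add: swap)
  have "L2_inner \<omega> (\<lambda>x. K x y) (Y n k) = 0" if "k \<in> \<I> n" for k
    using spherical_harmonics_orthogonal[OF m Y_harmonic[OF that]] assms(4) dimension by simp
  then show ?thesis using Y_expansion[OF n, of x] by simp
qed

text \<open>With the second variable at a pole, both kernels are invariant under rotations about the
  pole. The combination \<open>\<phi>\<close> also vanishes there, hence everywhere. The product
  form avoids dividing by \<open>zonal_kernel n z z\<close> before its value is known.\<close>

lemma invariant_kernel_eq_zonal_kernel:
  fixes K :: "real ^ 'n \<Rightarrow> real ^ 'n \<Rightarrow> complex"
  assumes inv: "\<And>h x y. h \<in> SO \<Longrightarrow> K (h *v x) (h *v y) = K x y"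
    and K1: "\<And>y. (\<lambda>x. K x y) \<in> spherical_harmonics n"
    and "norm y = 1" "norm z = 1"
  shows "zonal_kernel n z z * K x y = K z z * zonal_kernel n x y"
proof -
  fix k :: 'n
  let ?e = "axis k 1 :: real ^ 'n"
  let ?Z = "zonal_kernel n"
  define \<phi> where "\<phi> x = ?Z ?e ?e * K x ?e + (- K ?e ?e) * ?Z x ?e" for x
  have \<phi>: "\<phi> x = 0" for x
  proof (rule zonal_spherical_harmonic_eq_zero[OF dimension])
    show "\<phi> \<in> spherical_harmonics n"
      unfolding \<phi>_def by (intro spherical_harmonics_add spherical_harmonics_cmult K1 zonal_kernel_harmonic)
    show "\<phi> (h *v x) = \<phi> x" if "h \<in> SO" "h *v ?e = ?e" for h x
      using inv[OF that(1), of x ?e] zonal_kernel_SO[OF that(1), of n x ?e] by (simp add: \<phi>_def that(2))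
  qed (simp add: \<phi>_def)
  obtain h where h: "h \<in> SO" "h *v y = ?e"
    using sphere_transitive[OF assms(3), of ?e] by (auto simp: norm_axis_1)
  obtain h' where h': "h' \<in> SO" "h' *v z = ?e"
    using sphere_transitive[OF assms(4), of ?e] by (auto simp: norm_axis_1)
  have "K x y = K (h *v x) ?e" "?Z x y = ?Z (h *v x) ?e"
    using inv[OF h(1), of x y] zonal_kernel_SO[OF h(1), of n x y] by (simp_all add: h(2))
  moreover have "K z z = K ?e ?e" "?Z z z = ?Z ?e ?e"
    using inv[OF h'(1), of z z] zonal_kernel_SO[OF h'(1), of n z z] by (simp_all add: h'(2))
  ultimately show ?thesis
    using \<phi>[of "h *v x"] by (simp add: \<phi>_def)
qed

text \<open>By transitivity the diagonal is constant, hence equal to its mean, to which each of the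
  normalized basis functions contributes 1.\<close>

lemma zonal_kernel_diagonal:
  assumes "norm z = 1" shows "zonal_kernel n z z = of_nat (card (\<I> n))"
proof -
  have "(LINT x|\<omega>. zonal_kernel n x x) = (\<Sum>k\<in>\<I> n. L2_inner \<omega> (Y n k) (Y n k))"
    unfolding zonal_kernel_def L2_inner_def
    by (intro Bochner_Integration.integral_sum L2_integrable_mult Y_L2)
  also have "\<dots> = of_nat (card (\<I> n))" by (simp add: Y_inner)
  finally have "(LINT x|\<omega>. zonal_kernel n x x) = of_nat (card (\<I> n))" .
  moreover have "(LINT x|\<omega>. zonal_kernel n x x) = (LINT x|\<omega>. zonal_kernel n z z)"
  proof (intro Bochner_Integration.integral_cong refl)
    fix x assume "x \<in> space \<omega>"
    then obtain h where "h \<in> SO" "h *v x = z" using sphere_transitive[of x z] assms by auto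
    then show "zonal_kernel n x x = zonal_kernel n z z" using zonal_kernel_SO[of h n x x] by simp
  qed
  ultimately show ?thesis by simp
qed

lemma card_index_pos: "card (\<I> n) > 0"
proof -
  obtain f :: "real ^ 'n \<Rightarrow> complex" where f: "f \<in> spherical_harmonics n" "f \<noteq> (\<lambda>x. 0)"
    by (rule spherical_harmonics_nonzero[where 'n = 'n]) (use dimension in simp)
  then have "\<I> n \<noteq> {}" using Y_expansion[OF f(1)] by auto
  then show ?thesis using finite_index by (simp add: card_gt_0_iff)
qed

end

section \<open>Quadrature\<close>

lemma haar_integral_left:
  fixes F :: "real ^ 'n ^ 'n \<Rightarrow> complex"
  assumes \<mu>: "normalized_haar_SO \<mu>" and h: "h \<in> SO" and F: "continuous_on SO F"
  shows "(LINT s|\<mu>. F (h ** s)) = (LINT s|\<mu>. F s)"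
proof -
  have sets: "sets \<mu> = sets (restrict_space borel SO)"
    and distr: "distr \<mu> \<mu> (\<lambda>s. h ** s) = \<mu>"
    using \<mu> h by (auto simp: normalized_haar_SO_def)
  have "continuous_on UNIV (\<lambda>s. h ** s)"
    unfolding matrix_matrix_mult_def by (intro continuous_intros)
  then have m: "(\<lambda>s. h ** s) \<in> measurable \<mu> \<mu>"
    unfolding measurable_cong_sets[OF sets sets]
    by (intro measurable_restrict_space3 borel_measurable_continuous_onI) (auto intro: SO_mult h)
  have "F \<in> borel_measurable \<mu>"
    using F by (simp add: borel_measurable_continuous_on_restrict measurable_cong_sets[OF sets refl])
  from integral_distr[OF m this] show ?thesis by (simp only: distr)
qed

lemma haar_space: "normalized_haar_SO \<mu> \<Longrightarrow> space \<mu> = SO"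
  using sets_eq_imp_space_eq[of \<mu> "restrict_space borel SO"]
  by (simp add: normalized_haar_SO_def space_restrict_space)

text \<open>Provides the measurability in the rotation variable that a change of variables under the
  Haar measure requires.\<close>

lemma continuous_on_rot:
  assumes "\<Phi> \<in> sphere_polys N"
  shows "continuous_on SO (\<lambda>s. rot s \<Phi> x)"
proof -
  obtain P where P: "cpoly P" "\<Phi> = sphere_restrict P"
    using sphere_polys_restrict[OF assms] by blast
  have c: "continuous_on SO (\<lambda>s. if norm x = 1 then P (transpose s *v x) else 0)"
  proof (cases "norm x = 1")
    case True
    have "continuous_on SO (\<lambda>s :: real ^ 'a ^ 'a. transpose s *v x)"
      unfolding transpose_def matrix_vector_mult_def by (intro continuous_intros)
    then have "continuous_on SO (\<lambda>s. P (transpose s *v x))"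
      by (rule continuous_on_compose2[OF cpoly_continuous_on[OF P(1), of UNIV]]) simp
    then show ?thesis using True by simp
  qed simp
  show ?thesis
    by (rule continuous_on_eq[OF c])
      (simp add: rot_SO P(2) sphere_restrict_def SO_transpose
        del: transpose_matrix_vector vector_transpose_matrix)
qed

lemma spherical_harmonics_rot:
  "f \<in> spherical_harmonics n \<Longrightarrow> s \<in> SO \<Longrightarrow> rot s f \<in> spherical_harmonics n"
  by (simp add: rot_SO spherical_harmonics_SO SO_transpose
      del: transpose_matrix_vector vector_transpose_matrix)

context harmonic_basis
begin

lemma L2_inner_rot:
  assumes "s \<in> SO" "f \<in> L2 \<omega>" "g \<in> L2 \<omega>"
  shows "L2_inner \<omega> (rot s f) (rot s g) = L2_inner \<omega> f g"
  unfolding rot_SO[OF assms(1)] by (intro L2_inner_SO SO_transpose assms)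

lemma rot_sphere_polys_L2:
  assumes "\<Phi> \<in> sphere_polys N" "s \<in> SO" shows "rot s \<Phi> \<in> L2 \<omega>"
proof -
  obtain h where h: "\<And>n. h n \<in> spherical_harmonics n" "\<Phi> = (\<lambda>x. \<Sum>n\<le>N. h n x)"
    using sphere_polysE[OF assms(1)] by blast
  have "rot s \<Phi> = (\<lambda>x. \<Sum>n\<le>N. rot s (h n) x)" by (simp add: h(2) rot_def)
  then show ?thesis
    by (simp add: L2_sum spherical_harmonics_L2[OF spherical_harmonics_rot[OF h(1) assms(2)]])
qed

lemma sphere_polys_coeff:
  assumes h: "\<And>n. h n \<in> spherical_harmonics n" and k: "k \<in> \<I> n"
  shows "L2_inner \<omega> (\<lambda>x. \<Sum>m\<le>N. h m x) (Y n k) = (if n \<le> N then L2_inner \<omega> (h n) (Y n k) else 0)"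
proof -
  have "L2_inner \<omega> (\<lambda>x. \<Sum>m\<le>N. h m x) (Y n k) = (\<Sum>m\<le>N. L2_inner \<omega> (h m) (Y n k))"
    by (intro L2_inner_sum_left spherical_harmonics_L2[OF h] Y_L2 k)
  also have "\<dots> = (\<Sum>m\<le>N. if m = n then L2_inner \<omega> (h n) (Y n k) else 0)"
    using spherical_harmonics_orthogonal[OF h Y_harmonic[OF k]] dimension by (intro sum.cong refl) auto
  finally show ?thesis by simp
qed

text \<open>Brings point values of rotated polynomials into the scope of the quadrature formula:
  with \<open>x\<close> fixed, expansion in the basis shows that the dependence on \<open>s\<close>
  is a combination of matrix coefficients.\<close>

lemma matrix_coeff_span_rot:
  assumes "\<Phi> \<in> sphere_polys N"
  obtains f where "f \<in> matrix_coeff_span \<omega> \<I> Y N" "\<And>s. s \<in> SO \<Longrightarrow> f s = rot s \<Phi> x"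
proof -
  obtain h where h: "\<And>n. h n \<in> spherical_harmonics n" "\<Phi> = (\<lambda>x. \<Sum>n\<le>N. h n x)"
    using sphere_polysE[OF assms] by blast
  define f where "f s = (\<Sum>n\<le>N. \<Sum>m\<in>\<I> n. \<Sum>k\<in>\<I> n.
      (L2_inner \<omega> (h n) (Y n m) * Y n k x) * matrix_coeff \<omega> Y n k m s)" for s
  have "f \<in> matrix_coeff_span \<omega> \<I> Y N"
    unfolding f_def matrix_coeff_span_def
    by (intro cfun_span_sum cfun_span_cmult cfun.span_base) auto
  moreover have "f s = rot s \<Phi> x" if s: "s \<in> SO" for s
  proof -
    have "h n (transpose s *v x) = (\<Sum>m\<in>\<I> n. \<Sum>k\<in>\<I> n.
      (L2_inner \<omega> (h n) (Y n m) * Y n k x) * matrix_coeff \<omega> Y n k m s)" for n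
    proof -
      have "rot s (Y n m) x = (\<Sum>k\<in>\<I> n. matrix_coeff \<omega> Y n k m s * Y n k x)" if "m \<in> \<I> n" for m
        unfolding matrix_coeff_def
        by (rule Y_expansion[OF spherical_harmonics_rot[OF Y_harmonic[OF that] s]])
      then show ?thesis
        by (subst Y_expansion[OF h(1)], intro sum.cong refl)
          (simp add: rot_SO[OF s] sum_distrib_left mult_ac del: transpose_matrix_vector vector_transpose_matrix)
    qed
    then show ?thesis
      by (simp add: f_def rot_SO[OF s] h(2) del: transpose_matrix_vector vector_transpose_matrix)
  qed
  ultimately show ?thesis using that by blast
qed

end

locale sphere_quadrature = harmonic_basis \<omega> \<I> Y
  for \<omega> :: "(real ^ 'n) measure" and \<I> :: "nat \<Rightarrow> 'k set" and Y :: "nat \<Rightarrow> 'k \<Rightarrow> real ^ 'n \<Rightarrow> complex" +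
  fixes \<mu> :: "(real ^ 'n ^ 'n) measure" and N R :: nat and g :: "nat \<Rightarrow> real ^ 'n ^ 'n" and w :: "nat \<Rightarrow> real"
  assumes haar: "normalized_haar_SO \<mu>"
    and g_SO: "\<And>r. r \<in> {1..R} \<Longrightarrow> g r \<in> SO"
    and quad: "quadrature_on \<mu> (matrix_coeff_span \<omega> \<I> Y N) R g w"
begin

text \<open>\<open>\<Phi>\<close> is the synthesis function and \<open>\<Theta>\<close> the analysis
  function, in the opposite order to \<open>cross_energy\<close>.\<close>

definition kernel :: "(real ^ 'n \<Rightarrow> complex) \<Rightarrow> (real ^ 'n \<Rightarrow> complex) \<Rightarrow> real ^ 'n \<Rightarrow> real ^ 'n \<Rightarrow> complex" where
  "kernel \<Phi> \<Theta> x y = (\<Sum>r=1..R. of_real (w r) * rot (g r) \<Phi> x * cnj (rot (g r) \<Theta> y))"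

text \<open>The quadrature formula is for products without conjugation, so it is applied to
  \<open>\<Phi>\<close> and to the conjugate of \<open>\<Theta>\<close>, which is again a polynomial
  of degree at most \<open>N\<close>.\<close>

lemma kernel_eq_integral:
  assumes "\<Phi> \<in> sphere_polys N" "\<Theta> \<in> sphere_polys N"
  shows "kernel \<Phi> \<Theta> x y = (LINT s|\<mu>. rot s \<Phi> x * cnj (rot s \<Theta> y))"
proof -
  obtain f where f: "f \<in> matrix_coeff_span \<omega> \<I> Y N" "\<And>s. s \<in> SO \<Longrightarrow> f s = rot s \<Phi> x"
    using matrix_coeff_span_rot[OF assms(1)] by blast
  obtain f' where f': "f' \<in> matrix_coeff_span \<omega> \<I> Y N"
      "\<And>s. s \<in> SO \<Longrightarrow> f' s = rot s (\<lambda>x. cnj (\<Theta> x)) y"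
    using matrix_coeff_span_rot[OF sphere_polys_cnj[OF assms(2)]] by blast
  have "(LINT s|\<mu>. rot s \<Phi> x * cnj (rot s \<Theta> y)) = (LINT s|\<mu>. f s * f' s)"
    by (intro Bochner_Integration.integral_cong refl)
      (simp add: haar_space[OF haar] f(2) f'(2) rot_def)
  also have "\<dots> = (\<Sum>r=1..R. of_real (w r) * f (g r) * f' (g r))"
    using quad f(1) f'(1) by (simp add: quadrature_on_def)
  also have "\<dots> = kernel \<Phi> \<Theta> x y"
    unfolding kernel_def by (intro sum.cong refl) (simp add: f(2) f'(2) g_SO rot_def)
  finally show ?thesis by simp
qed

text \<open>Rotating both arguments by \<open>h\<close> multiplies the integration variable from the
  left by \<open>transpose h\<close>, and left invariance of the Haar measure absorbs it.\<close>

lemma kernel_SO: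
  assumes "\<Phi> \<in> sphere_polys N" "\<Theta> \<in> sphere_polys N" and h: "h \<in> SO"
  shows "kernel \<Phi> \<Theta> (h *v x) (h *v y) = kernel \<Phi> \<Theta> x y"
proof -
  have ht: "transpose h \<in> SO" using h by (rule SO_transpose)
  have "kernel \<Phi> \<Theta> (h *v x) (h *v y)
      = (LINT s|\<mu>. rot (transpose h ** s) \<Phi> x * cnj (rot (transpose h ** s) \<Theta> y))"
    unfolding kernel_eq_integral[OF assms(1,2)]
    by (intro Bochner_Integration.integral_cong refl)
      (simp add: haar_space[OF haar] rot_SO SO_mult ht matrix_transpose_mul matrix_vector_mul_assoc
        del: transpose_matrix_vector vector_transpose_matrix)
  also have "\<dots> = (LINT s|\<mu>. rot s \<Phi> x * cnj (rot s \<Theta> y))"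
    by (rule haar_integral_left[OF haar ht, of "\<lambda>s. rot s \<Phi> x * cnj (rot s \<Theta> y)"])
      (intro continuous_intros continuous_on_rot[OF assms(1)] continuous_on_rot[OF assms(2)])
  finally show ?thesis by (simp add: kernel_eq_integral[OF assms(1,2)])
qed

text \<open>Constants have degree 0 and so are covered for every \<open>N\<close>; the quadrature
  formula for the constant 1 gives the total Haar mass.\<close>

lemma sum_weights: "(\<Sum>r=1..R. complex_of_real (w r)) = 1"
proof -
  let ?c = "sphere_restrict (\<lambda>x. 1) :: real ^ 'n \<Rightarrow> complex"
  fix k :: 'n
  have c: "?c \<in> sphere_polys N"
    using harmonic_const by (intro spherical_harmonics_sphere_polys[of _ 0]) (auto simp: spherical_harmonics_def)
  have 1: "rot s ?c (axis k 1) = 1" if "s \<in> SO" for s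
    using that by (simp add: rot_SO sphere_restrict_def SO_transpose norm_axis_1
        del: transpose_matrix_vector vector_transpose_matrix)
  have "measure \<mu> (space \<mu>) = 1"
    using haar by (simp add: normalized_haar_SO_def haar_space[OF haar] measure_def)
  moreover have "kernel ?c ?c (axis k 1) (axis k 1) = (LINT s|\<mu>. 1)"
    unfolding kernel_eq_integral[OF c c]
    by (intro Bochner_Integration.integral_cong refl) (simp add: haar_space[OF haar] 1)
  ultimately have "kernel ?c ?c (axis k 1) (axis k 1) = 1" by simp
  then show ?thesis by (simp add: kernel_def 1 g_SO)
qed

lemma kernel_harmonic_left:
  assumes "f' \<in> spherical_harmonics n"
  shows "(\<lambda>x. kernel f' f x y) \<in> spherical_harmonics n"
proof -
  have "(\<lambda>x. kernel f' f x y) = (\<lambda>x. \<Sum>r=1..R. (of_real (w r) * cnj (rot (g r) f y)) * rot (g r) f' x)"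
    unfolding kernel_def by (simp add: mult_ac)
  also have "\<dots> \<in> spherical_harmonics n"
    by (intro spherical_harmonics_sum spherical_harmonics_cmult spherical_harmonics_rot assms g_SO)
  finally show ?thesis .
qed

lemma kernel_harmonic_right:
  assumes "f \<in> spherical_harmonics n"
  shows "(\<lambda>y. kernel f' f x y) \<in> spherical_harmonics n"
  unfolding kernel_def
  by (intro spherical_harmonics_sum spherical_harmonics_cmult spherical_harmonics_cnj spherical_harmonics_rot assms g_SO)

lemma kernel_off_diagonal:
  assumes "f' \<in> spherical_harmonics n" "f \<in> spherical_harmonics m" "n \<le> N" "m \<le> N" "n \<noteq> m" "norm y = 1"
  shows "kernel f' f x y = 0"
  by (rule invariant_kernel_eq_zero[OF kernel_SO kernel_harmonic_left kernel_harmonic_right])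
    (use assms spherical_harmonics_sphere_polys in auto)

text \<open>Only the constant has to be found. The diagonal of the invariant kernel is constant,
  hence equal to its mean; every rotation contributes the inner product of \<open>f'\<close> and
  \<open>f\<close> times its weight.\<close>

lemma kernel_diagonal:
  assumes f': "f' \<in> spherical_harmonics n" and f: "f \<in> spherical_harmonics n" and "n \<le> N" and y: "norm y = 1"
  shows "kernel f' f x y = L2_inner \<omega> f' f / of_nat (card (\<I> n)) * zonal_kernel n x y"
proof -
  have poly: "f' \<in> sphere_polys N" "f \<in> sphere_polys N"
    using assms spherical_harmonics_sphere_polys by auto
  have "(LINT x|\<omega>. kernel f' f x x) = (LINT x|\<omega>. kernel f' f y y)"
  proof (intro Bochner_Integration.integral_cong refl)
    fix x assume "x \<in> space \<omega>"
    then obtain h where "h \<in> SO" "h *v x = y" using sphere_transitive[of x y] y by auto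
    then show "kernel f' f x x = kernel f' f y y" using kernel_SO[OF poly, of h x x] by simp
  qed
  then have "kernel f' f y y = (LINT x|\<omega>. kernel f' f x x)" by simp
  also have "\<dots> = (\<Sum>r=1..R. of_real (w r) * L2_inner \<omega> (rot (g r) f') (rot (g r) f))"
    unfolding kernel_def L2_inner_def mult.assoc
    by (subst Bochner_Integration.integral_sum)
      (auto intro!: L2_integrable_mult integrable_mult_right spherical_harmonics_L2[OF spherical_harmonics_rot] f f' g_SO)
  also have "\<dots> = (\<Sum>r=1..R. of_real (w r)) * L2_inner \<omega> f' f"
    unfolding sum_distrib_right
    by (intro sum.cong refl)
      (simp add: L2_inner_rot g_SO spherical_harmonics_L2[OF f] spherical_harmonics_L2[OF f'])
  finally have "kernel f' f y y = L2_inner \<omega> f' f" by (simp only: sum_weights mult_1_left)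
  moreover have "zonal_kernel n y y * kernel f' f x y = kernel f' f y y * zonal_kernel n x y"
    by (rule invariant_kernel_eq_zonal_kernel[OF kernel_SO[OF poly] kernel_harmonic_left[OF f'] y y])
  ultimately show ?thesis
    using card_index_pos[of n] by (simp add: zonal_kernel_diagonal[OF y] field_simps)
qed

lemma quadrature_sum:
  assumes \<Phi>: "\<Phi> \<in> sphere_polys N" and \<Theta>: "\<Theta> \<in> sphere_polys N" and f: "f \<in> L2 \<omega>"
  shows "(\<Sum>r=1..R. of_real (w r) * L2_inner \<omega> f (rot (g r) \<Theta>) * rot (g r) \<Phi> x)
    = (\<Sum>n\<le>N. (\<Sum>k\<in>\<I> n. cnj (L2_inner \<omega> \<Theta> (Y n k)) * L2_inner \<omega> \<Phi> (Y n k)) / of_nat (card (\<I> n))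
         * (\<Sum>k\<in>\<I> n. L2_inner \<omega> f (Y n k) * Y n k x))"
proof -
  obtain p where p: "\<And>n. p n \<in> spherical_harmonics n" "\<Phi> = (\<lambda>x. \<Sum>n\<le>N. p n x)"
    using sphere_polysE[OF \<Phi>] by blast
  obtain t where t: "\<And>n. t n \<in> spherical_harmonics n" "\<Theta> = (\<lambda>x. \<Sum>n\<le>N. t n x)"
    using sphere_polysE[OF \<Theta>] by blast
  define c where "c n = (\<Sum>k\<in>\<I> n. cnj (L2_inner \<omega> \<Theta> (Y n k)) * L2_inner \<omega> \<Phi> (Y n k)) / of_nat (card (\<I> n))" for n
  \<comment> \<open>Parseval turns the sum over Fourier coefficients into the inner product of the
    degree-\<open>n\<close> components, which is the constant in
    \<open>kernel_diagonal\<close>.\<close>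
  have c: "c n = L2_inner \<omega> (p n) (t n) / of_nat (card (\<I> n))" if "n \<le> N" for n
    using that parseval[OF p(1) spherical_harmonics_L2[OF t(1)], of n]
    by (simp add: c_def p(2) t(2) sphere_polys_coeff[OF p(1)] sphere_polys_coeff[OF t(1)] mult.commute)
  have K: "kernel \<Phi> \<Theta> x y = (\<Sum>n\<le>N. c n * zonal_kernel n x y)" if y: "norm y = 1" for y
  proof -
    have "kernel \<Phi> \<Theta> x y = (\<Sum>r=1..R. \<Sum>n\<le>N. \<Sum>m\<le>N. of_real (w r) * rot (g r) (p n) x * cnj (rot (g r) (t m) y))"
      unfolding kernel_def p(2) t(2) rot_def mult.assoc
      by (intro sum.cong refl) (simp only: cnj_sum sum_product, simp only: sum_distrib_left)
    also have "\<dots> = (\<Sum>n\<le>N. \<Sum>m\<le>N. kernel (p n) (t m) x y)"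
      unfolding kernel_def by (subst sum.swap, rule sum.cong[OF refl], rule sum.swap)
    also have "\<dots> = (\<Sum>n\<le>N. \<Sum>m\<le>N. if n = m then c n * zonal_kernel n x y else 0)"
      using kernel_off_diagonal[OF p(1) t(1) _ _ _ y] kernel_diagonal[OF p(1) t(1) _ y]
      by (intro sum.cong refl) (auto simp: c)
    also have "\<dots> = (\<Sum>n\<le>N. c n * zonal_kernel n x y)"
      by simp
    finally show ?thesis .
  qed
  note rot\<Theta> = rot_sphere_polys_L2[OF \<Theta> g_SO]
  have "(\<Sum>r=1..R. of_real (w r) * L2_inner \<omega> f (rot (g r) \<Theta>) * rot (g r) \<Phi> x)
      = (\<Sum>r=1..R. L2_inner \<omega> f (\<lambda>y. (of_real (w r) * cnj (rot (g r) \<Phi> x)) * rot (g r) \<Theta> y))"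
    by (simp only: L2_inner_cmult_right) (simp add: mult_ac)
  also have "\<dots> = L2_inner \<omega> f (\<lambda>y. \<Sum>r=1..R. (of_real (w r) * cnj (rot (g r) \<Phi> x)) * rot (g r) \<Theta> y)"
    by (intro L2_inner_sum_right[symmetric] L2_cmult rot\<Theta> f)
  also have "\<dots> = (LINT y|\<omega>. f y * kernel \<Phi> \<Theta> x y)"
    by (simp add: L2_inner_def kernel_def mult_ac)
  also have "\<dots> = (LINT y|\<omega>. f y * (\<Sum>n\<le>N. c n * zonal_kernel n x y))"
    by (intro Bochner_Integration.integral_cong refl) (simp add: K)
  also have "\<dots> = L2_inner \<omega> f (\<lambda>y. \<Sum>n\<le>N. \<Sum>k\<in>\<I> n. (cnj (c n) * cnj (Y n k x)) * Y n k y)"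
    by (simp add: L2_inner_def zonal_kernel_def sum_distrib_left mult_ac)
  also have "\<dots> = (\<Sum>n\<le>N. L2_inner \<omega> f (\<lambda>y. \<Sum>k\<in>\<I> n. (cnj (c n) * cnj (Y n k x)) * Y n k y))"
    by (intro L2_inner_sum_right L2_sum L2_cmult Y_L2 f)
  also have "\<dots> = (\<Sum>n\<le>N. \<Sum>k\<in>\<I> n. L2_inner \<omega> f (\<lambda>y. (cnj (c n) * cnj (Y n k x)) * Y n k y))"
    by (intro sum.cong refl L2_inner_sum_right L2_cmult Y_L2 f)
  also have "\<dots> = (\<Sum>n\<le>N. c n * (\<Sum>k\<in>\<I> n. L2_inner \<omega> f (Y n k) * Y n k x))"
    by (simp only: L2_inner_cmult_right) (simp add: sum_distrib_left mult_ac)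
  finally show ?thesis by (simp only: c_def)
qed

text \<open>The case \<open>\<Phi> = \<Theta>\<close> of \<open>quadrature_sum\<close>, paired with
  \<open>f\<close>. It turns the contribution of one level to the frame sum into a weighted sum of
  the energies of \<open>f\<close>.\<close>

lemma quadrature_energy:
  assumes \<Theta>: "\<Theta> \<in> sphere_polys N" and f: "f \<in> L2 \<omega>"
  shows "(\<Sum>r=1..R. w r * (cmod (L2_inner \<omega> f (rot (g r) \<Theta>)))\<^sup>2)
    = (\<Sum>n\<le>N. (\<Sum>k\<in>\<I> n. (cmod (L2_inner \<omega> \<Theta> (Y n k)))\<^sup>2) / real (card (\<I> n))
         * (\<Sum>k\<in>\<I> n. (cmod (L2_inner \<omega> f (Y n k)))\<^sup>2))"
proof -
  define c where "c n = (\<Sum>k\<in>\<I> n. cnj (L2_inner \<omega> \<Theta> (Y n k)) * L2_inner \<omega> \<Theta> (Y n k)) / of_nat (card (\<I> n))" for n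
  have c: "c n = of_real ((\<Sum>k\<in>\<I> n. (cmod (L2_inner \<omega> \<Theta> (Y n k)))\<^sup>2) / real (card (\<I> n)))" for n
    by (simp add: c_def complex_norm_square[symmetric] mult.commute[of "cnj _"] del: of_real_power)
  note rot\<Theta> = rot_sphere_polys_L2[OF \<Theta> g_SO]
  let ?S = "\<lambda>x. \<Sum>r=1..R. of_real (w r) * L2_inner \<omega> f (rot (g r) \<Theta>) * rot (g r) \<Theta> x"
  have "L2_inner \<omega> ?S f = (\<Sum>r=1..R. of_real (w r) * L2_inner \<omega> f (rot (g r) \<Theta>) * L2_inner \<omega> (rot (g r) \<Theta>) f)"
    unfolding L2_inner_cmult_left[symmetric] by (intro L2_inner_sum_left L2_cmult rot\<Theta> f)
  also have "\<dots> = of_real (\<Sum>r=1..R. w r * (cmod (L2_inner \<omega> f (rot (g r) \<Theta>)))\<^sup>2)"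
    by (simp add: L2_inner_commute[of \<omega> "rot _ \<Theta>" f] mult.assoc complex_norm_square[symmetric] del: of_real_power)
  finally have 1: "L2_inner \<omega> ?S f = of_real (\<Sum>r=1..R. w r * (cmod (L2_inner \<omega> f (rot (g r) \<Theta>)))\<^sup>2)" .
  have "?S = (\<lambda>x. \<Sum>n\<le>N. c n * (\<Sum>k\<in>\<I> n. L2_inner \<omega> f (Y n k) * Y n k x))"
    using quadrature_sum[OF \<Theta> \<Theta> f] by (simp only: c_def)
  then have "L2_inner \<omega> ?S f = (\<Sum>n\<le>N. c n * (\<Sum>k\<in>\<I> n. L2_inner \<omega> f (Y n k) * L2_inner \<omega> (Y n k) f))"
    by (simp only:) (simp add: L2_inner_sum_left L2_sum L2_cmult Y_L2 f L2_inner_cmult_left)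
  also have "\<dots> = of_real (\<Sum>n\<le>N. (\<Sum>k\<in>\<I> n. (cmod (L2_inner \<omega> \<Theta> (Y n k)))\<^sup>2) / real (card (\<I> n))
         * (\<Sum>k\<in>\<I> n. (cmod (L2_inner \<omega> f (Y n k)))\<^sup>2))"
    unfolding c by (simp add: L2_inner_commute[of \<omega> "Y _ _" f] complex_norm_square[symmetric] del: of_real_power)
  finally show ?thesis using 1 by (simp only: of_real_eq_iff)
qed

end

section \<open>Frames and duality\<close>

locale quadrature_system = harmonic_basis \<omega> \<I> Y
  for \<omega> :: "(real ^ 'n) measure" and \<I> :: "nat \<Rightarrow> 'k set" and Y :: "nat \<Rightarrow> 'k \<Rightarrow> real ^ 'n \<Rightarrow> complex" +
  fixes \<mu> :: "(real ^ 'n ^ 'n) measure" and N R :: "nat \<Rightarrow> nat"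
    and g :: "nat \<Rightarrow> nat \<Rightarrow> real ^ 'n ^ 'n" and w :: "nat \<Rightarrow> nat \<Rightarrow> real"
  assumes quadrature: "\<And>j. sphere_quadrature \<omega> \<I> Y \<mu> (N j) (R j) (g j) (w j)"
    and weight_pos: "\<And>j r. r \<in> {1..R j} \<Longrightarrow> w j r > 0"
begin

definition energy :: "(real ^ 'n \<Rightarrow> complex) \<Rightarrow> nat \<Rightarrow> real" where
  "energy f n = (\<Sum>k\<in>\<I> n. (cmod (L2_inner \<omega> f (Y n k)))\<^sup>2)"

text \<open>For the pair at level \<open>j\<close> this is the multiplier \<open>c j n\<close> of
  the overview.\<close>

definition cross_energy :: "(real ^ 'n \<Rightarrow> complex) \<Rightarrow> (real ^ 'n \<Rightarrow> complex) \<Rightarrow> nat \<Rightarrow> complex" where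
  "cross_energy \<Theta> \<Phi> n = (\<Sum>k\<in>\<I> n. cnj (L2_inner \<omega> \<Theta> (Y n k)) * L2_inner \<omega> \<Phi> (Y n k)) / of_nat (card (\<I> n))"

text \<open>The multiplier in the case of equal analysis and synthesis functions, as a real
  number.\<close>

definition mean_energy :: "(real ^ 'n \<Rightarrow> complex) \<Rightarrow> nat \<Rightarrow> real" where
  "mean_energy \<Theta> n = energy \<Theta> n / real (card (\<I> n))"

lemma energy_nonneg: "0 \<le> energy f n"
  by (simp add: energy_def sum_nonneg)

lemma mean_energy_nonneg: "0 \<le> mean_energy f n"
  by (simp add: mean_energy_def energy_nonneg)

lemma coeff_eq_zero:
  assumes "\<Phi> \<in> sphere_polys M" "M < n" "k \<in> \<I> n" shows "L2_inner \<omega> \<Phi> (Y n k) = 0"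
proof -
  obtain h where h: "\<And>n. h n \<in> spherical_harmonics n" "\<Phi> = (\<lambda>x. \<Sum>n\<le>M. h n x)"
    using sphere_polysE[OF assms(1)] by blast
  show ?thesis using sphere_polys_coeff[OF h(1) assms(3), of M] assms(2) by (simp add: h(2))
qed

lemma mean_energy_eq_zero: "\<Phi> \<in> sphere_polys M \<Longrightarrow> M < n \<Longrightarrow> mean_energy \<Phi> n = 0"
  by (simp add: mean_energy_def energy_def coeff_eq_zero)

lemma cross_energy_eq_zero: "\<Phi> \<in> sphere_polys M \<Longrightarrow> M < n \<Longrightarrow> cross_energy \<Theta> \<Phi> n = 0"
  by (simp add: cross_energy_def coeff_eq_zero)

text \<open>Bounding \<open>a * b\<close> by \<open>a\<^sup>2 + b\<^sup>2\<close> separates the two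
  systems, so that each upper frame bound can be applied by itself.\<close>

lemma norm_cross_energy: "cmod (cross_energy \<Theta> \<Phi> n) \<le> mean_energy \<Theta> n + mean_energy \<Phi> n"
proof -
  have "cmod (\<Sum>k\<in>\<I> n. cnj (L2_inner \<omega> \<Theta> (Y n k)) * L2_inner \<omega> \<Phi> (Y n k))
    \<le> (\<Sum>k\<in>\<I> n. (cmod (L2_inner \<omega> \<Theta> (Y n k)))\<^sup>2 + (cmod (L2_inner \<omega> \<Phi> (Y n k)))\<^sup>2)"
  proof (rule sum_norm_le)
    fix k
    have "a * b \<le> a\<^sup>2 + b\<^sup>2" for a b :: real
      using sum_squares_bound[of a b] zero_le_power2[of a] zero_le_power2[of b] by linarith
    then show "cmod (cnj (L2_inner \<omega> \<Theta> (Y n k)) * L2_inner \<omega> \<Phi> (Y n k))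
        \<le> (cmod (L2_inner \<omega> \<Theta> (Y n k)))\<^sup>2 + (cmod (L2_inner \<omega> \<Phi> (Y n k)))\<^sup>2"
      by (simp add: norm_mult)
  qed
  then show ?thesis
    by (simp add: cross_energy_def mean_energy_def energy_def norm_divide sum.distrib
        add_divide_distrib[symmetric] divide_right_mono)
qed

text \<open>Instance of \<open>L2_norm_diff_orthonormal\<close> with multiplier times Fourier
  coefficient. The choice \<open>b = 1\<close> gives the remainder of the Fourier series, a general
  \<open>b\<close> that of the dual expansion.\<close>

lemma norm_minus_partial_sum:
  assumes f: "f \<in> L2 \<omega>"
  shows "(L2_norm \<omega> (\<lambda>x. f x - (\<Sum>n\<le>M. b n * (\<Sum>k\<in>\<I> n. L2_inner \<omega> f (Y n k) * Y n k x))))\<^sup>2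
    = (L2_norm \<omega> f)\<^sup>2 - (\<Sum>n\<le>M. energy f n) + (\<Sum>n\<le>M. (cmod (1 - b n))\<^sup>2 * energy f n)"
proof -
  let ?S = "SIGMA n:{..M}. \<I> n"
  have S: "(\<Sum>i\<in>?S. F i) = (\<Sum>n\<le>M. \<Sum>k\<in>\<I> n. F (n, k))" for F :: "nat \<times> 'k \<Rightarrow> 'b::comm_monoid_add"
    using sum.Sigma[of "{..M}" \<I> "\<lambda>n k. F (n, k)"] finite_index by simp
  have fin: "finite ?S" using finite_index by simp
  have eq: "(cmod (L2_inner \<omega> f (Y n k) - b n * L2_inner \<omega> f (Y n k)))\<^sup>2
      = (cmod (1 - b n))\<^sup>2 * (cmod (L2_inner \<omega> f (Y n k)))\<^sup>2" for n k
  proof -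
    have "L2_inner \<omega> f (Y n k) - b n * L2_inner \<omega> f (Y n k) = (1 - b n) * L2_inner \<omega> f (Y n k)"
      by (simp add: algebra_simps)
    then show ?thesis by (simp only: norm_mult power_mult_distrib)
  qed
  show ?thesis
    using L2_norm_diff_orthonormal[OF orthonormal_Y fin f, of "\<lambda>(n, k). b n * L2_inner \<omega> f (Y n k)"]
    by (simp add: S energy_def sum_distrib_left mult.assoc eq)
qed

lemma sum_energy_le: "f \<in> L2 \<omega> \<Longrightarrow> (\<Sum>n\<le>M. energy f n) \<le> (L2_norm \<omega> f)\<^sup>2"
  using norm_minus_partial_sum[where M = M and b = "\<lambda>_. 1" and f = f]
    zero_le_power2[of "L2_norm \<omega> (\<lambda>x. f x - (\<Sum>n\<le>M. 1 * (\<Sum>k\<in>\<I> n. L2_inner \<omega> f (Y n k) * Y n k x)))"]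
  by simp

lemma summable_energy: assumes "f \<in> L2 \<omega>" shows "summable (energy f)"
proof (rule summableI_nonneg_bounded)
  show "0 \<le> energy f n" for n by (rule energy_nonneg)
  show "(\<Sum>i<n. energy f i) \<le> (L2_norm \<omega> f)\<^sup>2" for n
    using sum_energy_le[OF assms, of n] energy_nonneg[of f n] by (simp add: lessThan_Suc_atMost[symmetric])
qed

section \<open>The frame inequalities in terms of energies\<close>

lemma frame_coeff:
  "(cmod (L2_inner \<omega> f (rotated_system g w \<Theta> (j, r))))\<^sup>2 = w j r * (cmod (L2_inner \<omega> f (rot (g j r) (\<Theta> j))))\<^sup>2"
  if "r \<in> {1..R j}"
  using weight_pos[OF that] unfolding rotated_system_def
  by (simp add: L2_inner_cmult_right norm_mult power_mult_distrib)

lemma sum_frame_coeff: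
  assumes \<Theta>: "\<And>j. \<Theta> j \<in> sphere_polys (N j)" and f: "f \<in> L2 \<omega>"
  shows "(\<Sum>i\<in>(SIGMA j:{..<J}. {1..R j}). (cmod (L2_inner \<omega> f (rotated_system g w \<Theta> i)))\<^sup>2)
    = (\<Sum>j<J. \<Sum>n\<le>N j. mean_energy (\<Theta> j) n * energy f n)"
proof -
  have "(\<Sum>i\<in>(SIGMA j:{..<J}. {1..R j}). (cmod (L2_inner \<omega> f (rotated_system g w \<Theta> i)))\<^sup>2)
    = (\<Sum>j<J. \<Sum>r=1..R j. (cmod (L2_inner \<omega> f (rotated_system g w \<Theta> (j, r))))\<^sup>2)"
    using sum.Sigma[of "{..<J}" "\<lambda>j. {1..R j}" "\<lambda>j r. (cmod (L2_inner \<omega> f (rotated_system g w \<Theta> (j, r))))\<^sup>2"]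
    by simp
  also have "\<dots> = (\<Sum>j<J. \<Sum>r=1..R j. w j r * (cmod (L2_inner \<omega> f (rot (g j r) (\<Theta> j))))\<^sup>2)"
    by (intro sum.cong refl frame_coeff)
  also have "\<dots> = (\<Sum>j<J. \<Sum>n\<le>N j. mean_energy (\<Theta> j) n * energy f n)"
    by (simp only: sphere_quadrature.quadrature_energy[OF quadrature \<Theta> f] mean_energy_def energy_def)
  finally show ?thesis .
qed

lemma energy_Y:
  assumes "k \<in> \<I> n" shows "energy (Y n k) m = (if m = n then 1 else 0)"
proof (cases "m = n")
  case True
  have "energy (Y n k) n = (\<Sum>l\<in>\<I> n. if l = k then 1 else 0)"
    unfolding energy_def using assms by (intro sum.cong refl) (auto simp: Y_inner)
  then show ?thesis using True assms finite_index by simp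
next
  case False
  then have "L2_inner \<omega> (Y n k) (Y m l) = 0" if "l \<in> \<I> m" for l
    using spherical_harmonics_orthogonal[OF Y_harmonic[OF assms] Y_harmonic[OF that]] dimension by simp
  then show ?thesis using False by (simp add: energy_def)
qed

lemma L2_norm_Y: "k \<in> \<I> n \<Longrightarrow> (L2_norm \<omega> (Y n k))\<^sup>2 = 1"
  using L2_norm_sq[of \<omega> "Y n k"] by (simp add: Y_inner del: of_real_power)

text \<open>A single basis function has norm 1 and all its energy in one degree, so testing the
  frame inequality on it isolates that degree. The bound is uniform in \<open>n\<close> and
  \<open>J\<close> because the frame constant is.\<close>

lemma frame_upper_bound:
  assumes \<Theta>: "\<And>j. \<Theta> j \<in> sphere_polys (N j)" and frame: "frame_generating \<omega> R g w \<Theta>"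
  obtains B where "\<And>J n. (\<Sum>j<J. mean_energy (\<Theta> j) n) \<le> B"
proof -
  obtain B where B: "\<And>f. f \<in> L2 \<omega> \<Longrightarrow> (\<lambda>i. (cmod (L2_inner \<omega> f (rotated_system g w \<Theta> i)))\<^sup>2) summable_on system_index R"
      "\<And>f. f \<in> L2 \<omega> \<Longrightarrow> (\<Sum>\<^sub>\<infinity>i\<in>system_index R. (cmod (L2_inner \<omega> f (rotated_system g w \<Theta> i)))\<^sup>2) \<le> B * (L2_norm \<omega> f)\<^sup>2"
    using frame unfolding frame_generating_def L2_frame_def by blast
  have "(\<Sum>j<J. mean_energy (\<Theta> j) n) \<le> B" for J n
  proof -
    obtain k where k: "k \<in> \<I> n" using card_index_pos[of n] by (metis card.empty ex_in_conv less_irrefl)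
    have "(\<Sum>j<J. mean_energy (\<Theta> j) n) = (\<Sum>j<J. \<Sum>m\<le>N j. mean_energy (\<Theta> j) m * energy (Y n k) m)"
    proof (intro sum.cong refl)
      fix j
      show "mean_energy (\<Theta> j) n = (\<Sum>m\<le>N j. mean_energy (\<Theta> j) m * energy (Y n k) m)"
        using mean_energy_eq_zero[OF \<Theta>, of j n]
        by (cases "n \<le> N j") (simp_all add: energy_Y[OF k] if_distrib cong: if_cong)
    qed
    also have "\<dots> = (\<Sum>i\<in>(SIGMA j:{..<J}. {1..R j}). (cmod (L2_inner \<omega> (Y n k) (rotated_system g w \<Theta> i)))\<^sup>2)"
      by (rule sum_frame_coeff[OF \<Theta> Y_L2[OF k], symmetric])
    also have "\<dots> \<le> (\<Sum>\<^sub>\<infinity>i\<in>system_index R. (cmod (L2_inner \<omega> (Y n k) (rotated_system g w \<Theta> i)))\<^sup>2)"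
      by (rule finite_sum_le_infsum[OF B(1)[OF Y_L2[OF k]]]) (auto simp: system_index_def)
    also have "\<dots> \<le> B" using B(2)[OF Y_L2[OF k]] by (simp add: L2_norm_Y[OF k])
    finally show ?thesis .
  qed
  then show ?thesis using that by blast
qed

text \<open>Replaces the unordered sum over pairs by sums over the first \<open>J\<close> levels:
  each finite set of indices lies within finitely many levels, and all terms are
  nonnegative.\<close>

lemma frame_lower_bound:
  assumes \<Theta>: "\<And>j. \<Theta> j \<in> sphere_polys (N j)" and frame: "frame_generating \<omega> R g w \<Theta>"
  obtains A where "A > 0"
    "\<And>f C. f \<in> L2 \<omega> \<Longrightarrow> (\<And>J. (\<Sum>j<J. \<Sum>n\<le>N j. mean_energy (\<Theta> j) n * energy f n) \<le> C)
      \<Longrightarrow> A * (L2_norm \<omega> f)\<^sup>2 \<le> C"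
proof -
  obtain A where A: "A > 0" "\<And>f. f \<in> L2 \<omega> \<Longrightarrow> (\<lambda>i. (cmod (L2_inner \<omega> f (rotated_system g w \<Theta> i)))\<^sup>2) summable_on system_index R"
      "\<And>f. f \<in> L2 \<omega> \<Longrightarrow> A * (L2_norm \<omega> f)\<^sup>2 \<le> (\<Sum>\<^sub>\<infinity>i\<in>system_index R. (cmod (L2_inner \<omega> f (rotated_system g w \<Theta> i)))\<^sup>2)"
    using frame unfolding frame_generating_def L2_frame_def by blast
  have "A * (L2_norm \<omega> f)\<^sup>2 \<le> C"
    if f: "f \<in> L2 \<omega>" and C: "\<And>J. (\<Sum>j<J. \<Sum>n\<le>N j. mean_energy (\<Theta> j) n * energy f n) \<le> C" for f C
  proof -
    have "(\<Sum>\<^sub>\<infinity>i\<in>system_index R. (cmod (L2_inner \<omega> f (rotated_system g w \<Theta> i)))\<^sup>2) \<le> C"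
    proof (rule infsum_le_finite_sums[OF A(2)[OF f]])
      fix F assume F: "finite F" "F \<subseteq> system_index R"
      define J where "J = Suc (\<Sum>i\<in>F. fst i)"
      have "fst i < J" if "i \<in> F" for i
        using member_le_sum[OF that, of fst] F(1) by (simp add: J_def)
      then have "F \<subseteq> (SIGMA j:{..<J}. {1..R j})"
        using F(2) by (fastforce simp: system_index_def)
      then have "(\<Sum>i\<in>F. (cmod (L2_inner \<omega> f (rotated_system g w \<Theta> i)))\<^sup>2)
          \<le> (\<Sum>i\<in>(SIGMA j:{..<J}. {1..R j}). (cmod (L2_inner \<omega> f (rotated_system g w \<Theta> i)))\<^sup>2)"
        by (intro sum_mono2) auto
      then show "(\<Sum>i\<in>F. (cmod (L2_inner \<omega> f (rotated_system g w \<Theta> i)))\<^sup>2) \<le> C"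
        using C[of J] by (simp only: sum_frame_coeff[OF \<Theta> f])
    qed
    then show ?thesis using A(3)[OF f] by linarith
  qed
  then show ?thesis using that A(1) by blast
qed

text \<open>The completeness of the spherical harmonics needs no density argument: both frame bounds,
  applied to the remainder of the Fourier series, bound its norm by the tail of the energies.\<close>

lemma energy_sums:
  assumes \<Theta>: "\<And>j. \<Theta> j \<in> sphere_polys (N j)" and frame: "frame_generating \<omega> R g w \<Theta>" and f: "f \<in> L2 \<omega>"
  shows "energy f sums (L2_norm \<omega> f)\<^sup>2"
proof -
  obtain B where B: "\<And>J n. (\<Sum>j<J. mean_energy (\<Theta> j) n) \<le> B"
    using frame_upper_bound[OF \<Theta> frame] by blast
  obtain A where A: "A > 0"
    "\<And>f C. f \<in> L2 \<omega> \<Longrightarrow> (\<And>J. (\<Sum>j<J. \<Sum>n\<le>N j. mean_energy (\<Theta> j) n * energy f n) \<le> C)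
      \<Longrightarrow> A * (L2_norm \<omega> f)\<^sup>2 \<le> C"
    using frame_lower_bound[OF \<Theta> frame] by blast
  have B0: "B \<ge> 0" using B[of 0 0] by simp
  let ?E = "suminf (energy f)"
  have bound: "A * ((L2_norm \<omega> f)\<^sup>2 - (\<Sum>n\<le>M. energy f n)) \<le> B * (?E - (\<Sum>n\<le>M. energy f n))" for M
  proof -
    define u where "u x = f x - (\<Sum>n\<le>M. \<Sum>k\<in>\<I> n. L2_inner \<omega> f (Y n k) * Y n k x)" for x
    have sL2: "(\<lambda>x. \<Sum>n\<le>M. \<Sum>k\<in>\<I> n. L2_inner \<omega> f (Y n k) * Y n k x) \<in> L2 \<omega>"
      by (intro L2_sum L2_cmult Y_L2)
    have u: "u \<in> L2 \<omega>" unfolding u_def by (intro L2_diff f sL2)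
    have uc: "L2_inner \<omega> u (Y n k) = (if n \<le> M then 0 else L2_inner \<omega> f (Y n k))" if k: "k \<in> \<I> n" for n k
    proof -
      have h: "(\<lambda>x. \<Sum>k\<in>\<I> n. L2_inner \<omega> f (Y n k) * Y n k x) \<in> spherical_harmonics n" for n
        by (intro spherical_harmonics_sum spherical_harmonics_cmult Y_harmonic)
      have "L2_inner \<omega> (\<lambda>x. \<Sum>k\<in>\<I> n. L2_inner \<omega> f (Y n k) * Y n k x) (Y n k)
          = (\<Sum>l\<in>\<I> n. if l = k then L2_inner \<omega> f (Y n k) else 0)"
        using k by (simp add: L2_inner_sum_left L2_cmult Y_L2 L2_inner_cmult_left Y_inner if_distrib cong: if_cong)
      then have "L2_inner \<omega> (\<lambda>x. \<Sum>k\<in>\<I> n. L2_inner \<omega> f (Y n k) * Y n k x) (Y n k) = L2_inner \<omega> f (Y n k)"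
        using k finite_index by simp
      then show ?thesis
        unfolding u_def by (simp add: L2_inner_diff_left f sL2 Y_L2 k sphere_polys_coeff[OF h k])
    qed
    have eu: "energy u n = (if n \<le> M then 0 else energy f n)" for n
      by (simp add: energy_def uc)
    have le: "(\<Sum>j<J. \<Sum>n\<le>N j. mean_energy (\<Theta> j) n * energy u n) \<le> B * (?E - (\<Sum>n\<le>M. energy f n))" for J
    proof -
      \<comment> \<open>A degree bound common to the first \<open>J\<close> levels, so that the
        order of summation can be exchanged; including \<open>M\<close> makes the subtracted partial
        sum part of the range.\<close>
      define L where "L = M + (\<Sum>j<J. N j)"
      have NL: "N j \<le> L" if "j < J" for j
        using member_le_sum[of j "{..<J}" N] that by (simp add: L_def)
      have "(\<Sum>j<J. \<Sum>n\<le>N j. mean_energy (\<Theta> j) n * energy u n)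
          \<le> (\<Sum>j<J. \<Sum>n\<le>L. mean_energy (\<Theta> j) n * energy u n)"
        by (intro sum_mono sum_mono2) (use NL in \<open>auto simp: energy_nonneg mean_energy_nonneg intro: order_trans\<close>)
      also have "\<dots> = (\<Sum>n\<le>L. (\<Sum>j<J. mean_energy (\<Theta> j) n) * energy u n)"
        by (subst sum.swap) (simp add: sum_distrib_right)
      also have "\<dots> \<le> (\<Sum>n\<le>L. B * energy u n)"
        by (intro sum_mono mult_right_mono B energy_nonneg)
      also have "\<dots> = B * (\<Sum>n\<le>L. energy u n)" by (simp add: sum_distrib_left)
      also have "(\<Sum>n\<le>L. energy u n) = (\<Sum>n\<le>L. energy f n) - (\<Sum>n\<le>M. energy f n)"
      proof -
        have "(\<Sum>n\<le>M. energy f n) = (\<Sum>n\<le>L. if n \<le> M then energy f n else 0)"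
          by (rule sum.mono_neutral_cong_left) (auto simp: L_def)
        then show ?thesis by (simp add: eu sum_subtractf[symmetric] if_distrib cong: if_cong)
      qed
      also have "B * \<dots> \<le> B * (?E - (\<Sum>n\<le>M. energy f n))"
        using B0 sum_le_suminf[OF summable_energy[OF f], of "{..L}"] energy_nonneg
        by (intro mult_left_mono) auto
      finally show ?thesis .
    qed
    have "A * (L2_norm \<omega> u)\<^sup>2 \<le> B * (?E - (\<Sum>n\<le>M. energy f n))"
      by (rule A(2)[OF u le])
    moreover have "(L2_norm \<omega> u)\<^sup>2 = (L2_norm \<omega> f)\<^sup>2 - (\<Sum>n\<le>M. energy f n)"
      using norm_minus_partial_sum[OF f, where M = M and b = "\<lambda>_. 1"] by (simp add: u_def[abs_def])
    ultimately show ?thesis by simp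
  qed
  have lim: "(\<lambda>M. \<Sum>n\<le>M. energy f n) \<longlonglongrightarrow> ?E"
    using summable_energy[OF f] by (simp add: summable_LIMSEQ')
  \<comment> \<open>As \<open>M\<close> grows the tail of energies tends to 0. Since
    \<open>A > 0\<close>, the gap in Bessel's inequality cannot be positive.\<close>
  have "A * ((L2_norm \<omega> f)\<^sup>2 - ?E) \<le> B * (?E - ?E)"
  proof (rule LIMSEQ_le)
    show "(\<lambda>M. A * ((L2_norm \<omega> f)\<^sup>2 - (\<Sum>n\<le>M. energy f n))) \<longlonglongrightarrow> A * ((L2_norm \<omega> f)\<^sup>2 - ?E)"
      by (intro tendsto_intros lim)
    show "(\<lambda>M. B * (?E - (\<Sum>n\<le>M. energy f n))) \<longlonglongrightarrow> B * (?E - ?E)"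
      by (intro tendsto_intros lim)
  qed (use bound in blast)
  then have "(L2_norm \<omega> f)\<^sup>2 \<le> ?E"
    using A(1) by (simp add: mult_le_0_iff)
  moreover have "?E \<le> (L2_norm \<omega> f)\<^sup>2"
    by (rule LIMSEQ_le_const2[OF lim]) (use sum_energy_le[OF f] in auto)
  ultimately show ?thesis
    using summable_sums[OF summable_energy[OF f]] by simp
qed

text \<open>Up to the largest degree occurring in the first \<open>J\<close> levels this is
  \<open>norm_minus_partial_sum\<close>. Beyond it the multipliers are 0, and by
  \<open>energy_sums\<close> the energies left over are exactly the missing terms of the
  series.\<close>

lemma dual_remainder_sums:
  assumes \<Theta>: "\<And>j. \<Theta> j \<in> sphere_polys (N j)" and \<Phi>: "\<And>j. \<Phi> j \<in> sphere_polys (N j)"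
    and frame: "frame_generating \<omega> R g w \<Theta>" and f: "f \<in> L2 \<omega>"
  shows "(\<lambda>n. (cmod (1 - (\<Sum>j<J. cross_energy (\<Theta> j) (\<Phi> j) n)))\<^sup>2 * energy f n) sums
    (L2_norm \<omega> (\<lambda>x. f x - (\<Sum>j<J. \<Sum>r=1..R j. of_real (w j r) * L2_inner \<omega> f (rot (g j r) (\<Theta> j))
       * rot (g j r) (\<Phi> j) x)))\<^sup>2"
proof -
  define b where "b n = (\<Sum>j<J. cross_energy (\<Theta> j) (\<Phi> j) n)" for n
  define M where "M = (\<Sum>j<J. N j)"
  have NM: "N j \<le> M" if "j < J" for j
    using member_le_sum[of j "{..<J}" N] that by (simp add: M_def)
  let ?P = "\<lambda>n x. \<Sum>k\<in>\<I> n. L2_inner \<omega> f (Y n k) * Y n k x"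
  have "(\<Sum>j<J. \<Sum>r=1..R j. of_real (w j r) * L2_inner \<omega> f (rot (g j r) (\<Theta> j)) * rot (g j r) (\<Phi> j) x)
      = (\<Sum>n\<le>M. b n * ?P n x)" for x
  proof -
    have "(\<Sum>j<J. \<Sum>r=1..R j. of_real (w j r) * L2_inner \<omega> f (rot (g j r) (\<Theta> j)) * rot (g j r) (\<Phi> j) x)
      = (\<Sum>j<J. \<Sum>n\<le>N j. cross_energy (\<Theta> j) (\<Phi> j) n * ?P n x)"
      by (simp only: sphere_quadrature.quadrature_sum[OF quadrature \<Phi> \<Theta> f] cross_energy_def)
    also have "\<dots> = (\<Sum>j<J. \<Sum>n\<le>M. cross_energy (\<Theta> j) (\<Phi> j) n * ?P n x)"
    proof (rule sum.cong[OF refl], rule sum.mono_neutral_left)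
      fix j assume "j \<in> {..<J}"
      then show "{..N j} \<subseteq> {..M}" using NM by simp
      show "\<forall>n\<in>{..M} - {..N j}. cross_energy (\<Theta> j) (\<Phi> j) n * ?P n x = 0"
        using cross_energy_eq_zero[OF \<Phi>, of j] by simp
    qed simp
    also have "\<dots> = (\<Sum>n\<le>M. b n * ?P n x)"
      by (subst sum.swap) (simp add: b_def sum_distrib_right)
    finally show ?thesis .
  qed
  then have "(L2_norm \<omega> (\<lambda>x. f x - (\<Sum>j<J. \<Sum>r=1..R j. of_real (w j r) * L2_inner \<omega> f (rot (g j r) (\<Theta> j))
       * rot (g j r) (\<Phi> j) x)))\<^sup>2
     = (L2_norm \<omega> f)\<^sup>2 - (\<Sum>n\<le>M. energy f n) + (\<Sum>n\<le>M. (cmod (1 - b n))\<^sup>2 * energy f n)"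
    by (simp only: norm_minus_partial_sum[OF f])
  moreover have "(\<lambda>n. energy f n - (if n \<in> {..M} then energy f n else 0)
        + (if n \<in> {..M} then (cmod (1 - b n))\<^sup>2 * energy f n else 0))
     sums ((L2_norm \<omega> f)\<^sup>2 - (\<Sum>n\<le>M. energy f n) + (\<Sum>n\<le>M. (cmod (1 - b n))\<^sup>2 * energy f n))"
    by (intro sums_add sums_diff energy_sums[OF \<Theta> frame f] sums_If_finite_set finite_atMost)
  moreover have "energy f n - (if n \<in> {..M} then energy f n else 0)
        + (if n \<in> {..M} then (cmod (1 - b n))\<^sup>2 * energy f n else 0)
     = (cmod (1 - b n))\<^sup>2 * energy f n" for n
  proof (cases "n \<le> M")
    case False
    then have "b n = 0"
      unfolding b_def using NM by (intro sum.neutral ballI cross_energy_eq_zero[OF \<Phi>]) fastforce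
    then show ?thesis using False by simp
  qed simp
  ultimately show ?thesis by (simp only: b_def)
qed

lemma dual_iff:
  assumes \<Theta>: "\<And>j. \<Theta> j \<in> sphere_polys (N j)" and \<Phi>: "\<And>j. \<Phi> j \<in> sphere_polys (N j)"
    and frame: "frame_generating \<omega> R g w \<Theta>" "frame_generating \<omega> R g w \<Phi>"
  shows "(\<forall>f\<in>L2 \<omega>. L2_sums \<omega> (\<lambda>j x. \<Sum>r=1..R j. of_real (w j r) * L2_inner \<omega> f (rot (g j r) (\<Theta> j))
              * rot (g j r) (\<Phi> j) x) f)
    \<longleftrightarrow> (\<forall>n. (\<lambda>j. cross_energy (\<Theta> j) (\<Phi> j) n) sums 1)" (is "?L \<longleftrightarrow> ?R")
proof -
  define D where "D f J = L2_norm \<omega> (\<lambda>x. f x - (\<Sum>j<J. \<Sum>r=1..R j. of_real (w j r) * L2_inner \<omega> f (rot (g j r) (\<Theta> j))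
              * rot (g j r) (\<Phi> j) x))" for f J
  define b where "b J n = (\<Sum>j<J. cross_energy (\<Theta> j) (\<Phi> j) n)" for J n
  have D: "(\<lambda>n. (cmod (1 - b J n))\<^sup>2 * energy f n) sums (D f J)\<^sup>2" if "f \<in> L2 \<omega>" for f J
    unfolding b_def D_def by (rule dual_remainder_sums[OF \<Theta> \<Phi> frame(1) that])
  have L: "?L \<longleftrightarrow> (\<forall>f\<in>L2 \<omega>. D f \<longlonglongrightarrow> 0)"
    by (simp add: L2_sums_def D_def[abs_def])
  have R: "?R \<longleftrightarrow> (\<forall>n. (\<lambda>J. b J n) \<longlonglongrightarrow> 1)"
    by (simp add: sums_def b_def)
  show ?thesis unfolding L R
  proof (intro iffI allI ballI)
    fix n assume lim: "\<forall>f\<in>L2 \<omega>. D f \<longlonglongrightarrow> 0"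
    obtain k where k: "k \<in> \<I> n" using card_index_pos[of n] by (metis card.empty ex_in_conv less_irrefl)
    \<comment> \<open>On a basis function the remainder series has a single term, so convergence for
      this one function already decides the degree \<open>n\<close>.\<close>
    have "D (Y n k) J = cmod (1 - b J n)" for J
    proof -
      have "(\<lambda>m. if m = n then (cmod (1 - b J m))\<^sup>2 else 0) sums (D (Y n k) J)\<^sup>2"
        using D[OF Y_L2[OF k], of J] by (simp add: energy_Y[OF k] if_distrib cong: if_cong)
      then have "(D (Y n k) J)\<^sup>2 = (cmod (1 - b J n))\<^sup>2"
        using sums_unique2[OF sums_single[of n "\<lambda>m. (cmod (1 - b J m))\<^sup>2"]] by simp
      then show ?thesis
        by (simp add: D_def L2_norm_nonneg)
    qed
    then have "D (Y n k) = (\<lambda>J. cmod (1 - b J n))" by blast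
    then have "(\<lambda>J. 1 - b J n) \<longlonglongrightarrow> 0"
      using lim Y_L2[OF k] by (metis tendsto_norm_zero_cancel)
    then show "(\<lambda>J. b J n) \<longlonglongrightarrow> 1"
      using tendsto_diff[OF tendsto_const[of 1]] by fastforce
  next
    fix f assume lim: "\<forall>n. (\<lambda>J. b J n) \<longlonglongrightarrow> 1" and f: "f \<in> L2 \<omega>"
    obtain B where B: "\<And>J n. (\<Sum>j<J. mean_energy (\<Theta> j) n) \<le> B"
      using frame_upper_bound[OF \<Theta> frame(1)] by blast
    obtain B' where B': "\<And>J n. (\<Sum>j<J. mean_energy (\<Phi> j) n) \<le> B'"
      using frame_upper_bound[OF \<Phi> frame(2)] by blast
    have bb: "cmod (1 - b J n) \<le> 1 + (B + B')" for J n
    proof -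
      have "cmod (b J n) \<le> (\<Sum>j<J. mean_energy (\<Theta> j) n + mean_energy (\<Phi> j) n)"
        unfolding b_def by (rule sum_norm_le) (rule norm_cross_energy)
      also have "\<dots> \<le> B + B'" using B[of n J] B'[of n J] by (simp add: sum.distrib)
      finally show ?thesis using norm_triangle_ineq4[of 1 "b J n"] by simp
    qed
    \<comment> \<open>Tannery's theorem exchanges the limit in \<open>J\<close> with the sum over
      degrees; the majorant is a constant times the summable energies.\<close>
    have "(\<lambda>J. suminf (\<lambda>n. (cmod (1 - b J n))\<^sup>2 * energy f n)) \<longlonglongrightarrow> suminf (\<lambda>n. (cmod (1 - 1))\<^sup>2 * energy f n)"
    proof (rule tannerys_theorem[THEN conjunct2, THEN conjunct2])
      show "(\<lambda>J. (cmod (1 - b J n))\<^sup>2 * energy f n) \<longlonglongrightarrow> (cmod (1 - 1))\<^sup>2 * energy f n" for n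
        using lim by (intro tendsto_intros) auto
      show "\<forall>\<^sub>F (n, J) in at_top \<times>\<^sub>F sequentially.
          norm ((cmod (1 - b J n))\<^sup>2 * energy f n) \<le> (1 + (B + B'))\<^sup>2 * energy f n"
        using bb by (intro always_eventually)
          (auto simp: abs_mult energy_nonneg intro!: mult_right_mono power_mono)
      show "summable (\<lambda>n. (1 + (B + B'))\<^sup>2 * energy f n)"
        by (intro summable_mult summable_energy f)
    qed simp
    then have "(\<lambda>J. (D f J)\<^sup>2) \<longlonglongrightarrow> 0"
      using D[OF f] by (simp add: sums_iff)
    then have "(\<lambda>J. sqrt ((D f J)\<^sup>2)) \<longlonglongrightarrow> sqrt 0" by (rule tendsto_real_sqrt)
    moreover have "D f J \<ge> 0" for J by (simp add: D_def L2_norm_nonneg)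
    ultimately show "D f \<longlonglongrightarrow> 0" by simp
  qed
qed

end

text \<open>\<open>suminf\<close> is a total function, so convergence is required separately on the
  right. On the left each finite sum over \<open>r\<close> counts as one term of the series over
  \<open>j\<close>.\<close>

theorem proposition3p2:
  fixes \<omega> :: "(real ^ 'n) measure"
    and \<mu> :: "(real ^ 'n ^ 'n) measure"
    and \<I> :: "nat \<Rightarrow> 'k set"
    and Y :: "nat \<Rightarrow> 'k \<Rightarrow> real ^ 'n \<Rightarrow> complex"
    and N R :: "nat \<Rightarrow> nat"
    and g :: "nat \<Rightarrow> nat \<Rightarrow> real ^ 'n ^ 'n"
    and w :: "nat \<Rightarrow> nat \<Rightarrow> real"
    and \<Psi> \<Psi>' :: "nat \<Rightarrow> real ^ 'n \<Rightarrow> complex"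
  assumes "CARD('n) \<ge> 3"
    and "invariant_sphere_measure \<omega>"
    and "normalized_haar_SO \<mu>"
    and "\<And>n. finite (\<I> n)"
    and "\<And>n. card (\<I> n) = cfun.dim (spherical_harmonics n :: (real ^ 'n \<Rightarrow> complex) set)"
    and "\<And>n. orthonormal_basis_of \<omega> (spherical_harmonics n) (\<I> n) (Y n)"
    and "mono N"
    and "\<And>j r. r \<in> {1..R j} \<Longrightarrow> g j r \<in> SO"
    and "\<And>j r. r \<in> {1..R j} \<Longrightarrow> w j r > 0"
    and "\<And>j. quadrature_on \<mu> (matrix_coeff_span \<omega> \<I> Y (N j)) (R j) (g j) (w j)"
    and "\<And>j. \<Psi> j \<in> sphere_polys (N j)"
    and "\<And>j. \<Psi>' j \<in> sphere_polys (N j)"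
    and "frame_generating \<omega> R g w \<Psi>"
    and "frame_generating \<omega> R g w \<Psi>'"
  shows "(\<forall>f\<in>L2 \<omega>.
            L2_sums \<omega>
              (\<lambda>j x. \<Sum>r=1..R j. of_real (w j r) * L2_inner \<omega> f (rot (g j r) (\<Psi> j))
                                     * rot (g j r) (\<Psi>' j) x)
              f) \<longleftrightarrow>
         (\<forall>n. summable (\<lambda>j. \<Sum>k\<in>\<I> n. cnj (L2_inner \<omega> (\<Psi> j) (Y n k)) * L2_inner \<omega> (\<Psi>' j) (Y n k)) \<and>
              inverse (of_nat (cfun.dim (spherical_harmonics n :: (real ^ 'n \<Rightarrow> complex) set))) *
              (\<Sum>j. \<Sum>k\<in>\<I> n. cnj (L2_inner \<omega> (\<Psi> j) (Y n k)) * L2_inner \<omega> (\<Psi>' j) (Y n k)) = 1)"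
proof -
  have quad: "sphere_quadrature \<omega> \<I> Y \<mu> (N j) (R j) (g j) (w j)" for j
    by unfold_locales (use assms in auto)
  interpret quadrature_system \<omega> \<I> Y \<mu> N R g w
    by unfold_locales (use assms quad in auto)
  have dim: "of_nat (cfun.dim (spherical_harmonics n :: (real ^ 'n \<Rightarrow> complex) set)) = (of_nat (card (\<I> n)) :: complex)"
      and pos: "(of_nat (card (\<I> n)) :: complex) \<noteq> 0" for n
    using assms(5)[of n] card_index_pos[of n] by simp_all
  \<comment> \<open>Dividing each term by the nonzero dimension affects neither summability nor, up
    to that factor, the sum.\<close>
  have "(\<lambda>j. cross_energy (\<Psi> j) (\<Psi>' j) n) sums 1 \<longleftrightarrow>
      summable (\<lambda>j. \<Sum>k\<in>\<I> n. cnj (L2_inner \<omega> (\<Psi> j) (Y n k)) * L2_inner \<omega> (\<Psi>' j) (Y n k)) \<and>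
      inverse (of_nat (card (\<I> n))) *
        (\<Sum>j. \<Sum>k\<in>\<I> n. cnj (L2_inner \<omega> (\<Psi> j) (Y n k)) * L2_inner \<omega> (\<Psi>' j) (Y n k)) = 1" for n
    using pos[of n] by (simp add: cross_energy_def sums_iff summable_divide_iff suminf_divide divide_inverse
        mult.commute[of _ "inverse _"] summable_cmult_iff cong: conj_cong) (auto simp: suminf_mult)
  then show ?thesis
    unfolding dim dual_iff[OF assms(11,12,13,14)] by simp
qed

end
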